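(* Let $H$ be an ordered graph. If $m(F)>m_2(H)$ for each ordered graph $F\in R_<(H)$, then $H$ is Ramsey infinite.
   Context: An ordered graph is a finite simple graph together with a linear order of its vertex set. A copy of an ordered graph $H$ in $F$ is a subgraph of $F$ (with inherited order) isomorphic to $H$ via an order-preserving bijection. $R_<(H)$ is the set of ordered graphs $F$ such that every red/blue coloring of the edges of $F$ contains a monochromatic copy of $H$. $F\in R_<(H)$ is minimal if no proper (ordered) subgraph of $F$ lies in $R_<(H)$. $H$ is Ramsey finite if $R_<(H)$ has only finitely many minimal elements (up to order-preserving isomorphism), and Ramsey infinite otherwise. The density of a graph $G$ is $m(G)=\max\{|E(G')|/|V(G')| : G'\subseteq G\}$ and its $2$-density is $m_2(G)=\max\{(|E(G')|-1)/(|V(G')|-2) : G'\subseteq G,\ |V(G')|\ge 3,\ |E(G')|\ge 1\}$.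
   Formalization: Ordered graphs H with exactly one edge are excluded: on at least three vertices such H has m_2(H)=0<m(F) for all F in R_<(H) yet is Ramsey finite, and m_2(K_2) is undefined; for edgeless H the undefined m_2(H) is read as 0. *)

theory Defs
  imports Complex_Main
begin

text \<open>The linear order on the vertex set of an ordered graph is the one inherited from the
  vertex type.\<close>

datatype 'a ograph = OGraph (verts: "'a set") (edges: "'a set set")

definition ordered_graph :: "'a::linorder ograph \<Rightarrow> bool" where
  "ordered_graph G \<longleftrightarrow>
     finite (verts G) \<and> (\<forall>e\<in>edges G. e \<subseteq> verts G \<and> card e = 2)"

definition subgraph :: "'a::linorder ograph \<Rightarrow> 'a ograph \<Rightarrow> bool" where
  "subgraph G' G \<longleftrightarrow>
     ordered_graph G' \<and> ordered_graph G \<and> verts G' \<subseteq> verts G \<and> edges G' \<subseteq> edges G"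

definition ograph_iso :: "'a::linorder ograph \<Rightarrow> 'b::linorder ograph \<Rightarrow> bool" where
  "ograph_iso G G' \<longleftrightarrow>
     (\<exists>f. bij_betw f (verts G) (verts G') \<and> strict_mono_on (verts G) f \<and>
          edges G' = (\<lambda>e. f ` e) ` edges G)"

definition is_copy :: "'a::linorder ograph \<Rightarrow> 'b::linorder ograph \<Rightarrow> 'b ograph \<Rightarrow> bool" where
  "is_copy H F C \<longleftrightarrow> subgraph C F \<and> ograph_iso H C"

text \<open>A colouring is a total function on vertex sets of which only the values on edges matter.\<close>

definition monochromatic :: "('a set \<Rightarrow> bool) \<Rightarrow> 'a ograph \<Rightarrow> bool" where
  "monochromatic c G \<longleftrightarrow> (\<exists>col. \<forall>e\<in>edges G. c e = col)"

text \<open>Host graphs live on finite sets of natural numbers. By \<open>ex_nat_ograph_iso\<close>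
  this represents all ordered graphs up to isomorphism.\<close>

definition ramsey_graphs :: "'a::linorder ograph \<Rightarrow> nat ograph set" where
  "ramsey_graphs H = {F. ordered_graph F \<and>
     (\<forall>c :: nat set \<Rightarrow> bool. \<exists>C. is_copy H F C \<and> monochromatic c C)}"

definition minimal_ramsey_graphs :: "'a::linorder ograph \<Rightarrow> nat ograph set" where
  "minimal_ramsey_graphs H =
     {F \<in> ramsey_graphs H. \<forall>F'. subgraph F' F \<and> F' \<noteq> F \<longrightarrow> F' \<notin> ramsey_graphs H}"

definition ramsey_finite :: "'a::linorder ograph \<Rightarrow> bool" where
  "ramsey_finite H \<longleftrightarrow> finite (minimal_ramsey_graphs H // {(F, F'). ograph_iso F F'})"

abbreviation ramsey_infinite :: "'a::linorder ograph \<Rightarrow> bool" where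
  "ramsey_infinite H \<equiv> \<not> ramsey_finite H"

text \<open>The graph without vertices contributes \<open>0 / 0 = 0\<close>, which does not affect the maximum.\<close>

definition density :: "'a::linorder ograph \<Rightarrow> real" where
  "density G = Max {real (card (edges G')) / real (card (verts G')) | G'. subgraph G' G}"

text \<open>All the quotients are nonnegative, so the inserted \<open>0\<close> only fixes the value for graphs
  without admissible subgraphs. A graph with exactly one edge also has value \<open>0\<close>: the single
  edge \<open>K\<^sub>2\<close> is not assigned the separate value \<open>1 / 2\<close> that is sometimes used for it.\<close>

definition two_density :: "'a::linorder ograph \<Rightarrow> real" where
  "two_density G = Max (insert 0
     {(real (card (edges G')) - 1) / (real (card (verts G')) - 2) | G'.
        subgraph G' G \<and> card (verts G') \<ge> 3 \<and> card (edges G') \<ge> 1})"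

lemma ex_nat_ograph_iso:
  fixes G :: "'a::linorder ograph"
  assumes "ordered_graph G"
  shows "\<exists>G' :: nat ograph. ordered_graph G' \<and> ograph_iso G G'"
proof -
  define f where "f v = card {u \<in> verts G. u < v}" for v
  have fin: "finite (verts G)" using assms by (simp add: ordered_graph_def)
  have mono: "strict_mono_on (verts G) f"
  proof (rule strict_mono_onI)
    fix u v assume "u \<in> verts G" "v \<in> verts G" "u < v"
    then have "{w \<in> verts G. w < u} \<subset> {w \<in> verts G. w < v}" by force
    then show "f u < f v" unfolding f_def using fin by (intro psubset_card_mono) auto
  qed
  then have inj: "inj_on f (verts G)" by (rule strict_mono_on_imp_inj_on)
  let ?G' = "OGraph (f ` verts G) ((\<lambda>e. f ` e) ` edges G)"
  have "card (f ` e) = 2" if "e \<in> edges G" for e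
    using that assms inj_on_subset[OF inj] by (simp add: ordered_graph_def card_image)
  then have "ordered_graph ?G'" using assms by (auto simp: ordered_graph_def)
  moreover have "ograph_iso G ?G'"
    unfolding ograph_iso_def using inj mono by (auto simp: bij_betw_def intro!: exI[of _ f])
  ultimately show ?thesis by blast
qed

end

theory Submission
  imports Defs "HOL-Library.Ramsey" "HOL-Real_Asymp.Real_Asymp"
begin

text \<open>If \<open>H\<close> were Ramsey finite, then the finitely many minimal graphs would all contain a bounded set of
  vertices spanning more than \<open>m\<^sub>2(H)\<close> edges per vertex, and so would every member of \<open>R\<^sub><(H)\<close>. It
  therefore suffices to find a Ramsey graph without dense vertex sets of size at most \<open>K\<close>. Take the
  random graph with edge probability \<open>n\<^bsup>- 1 / \<theta>\<^esup>\<close>, where \<open>\<theta>\<close> exceeds \<open>m\<^sub>2(H)\<close> so slightly that no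
  dense vertex set of size at most \<open>K\<close> is expected.

  That it is Ramsey follows from hypergraph containers. The edge sets of the copies of \<open>H\<close> in the
  complete graph form a hypergraph whose independent sets are covered by \<open>n\<^bsup>O(b)\<^esup>\<close> containers with
  few copies each, where \<open>b\<close> is about \<open>n\<^bsup>2 - 1 / m\<^sub>2(H)\<^esup>\<close>. By Ramsey's theorem two such containers
  miss a positive proportion of all pairs, so the random graph lies in their union with probability at
  most \<open>exp (- c n\<^bsup>2 - 1 / \<theta>\<^esup>)\<close>. As \<open>\<theta> > m\<^sub>2(H)\<close> leaves a polynomial factor to spare, a plain union
  bound over all pairs of containers is enough.

  The containers come from repeatedly picking vertices of high degree in an independent set and
  collecting their links into a hypergraph of lower uniformity (compare Nenadov and Pham).\<close>

subsection \<open>Hypergraph containers\<close>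

text \<open>Weights act as multiplicities: one set can arise as the link of several picked vertices,
  and several copies of \<open>H\<close> can have the same edge set. \<open>wdeg A w {}\<close> is
  the total weight.\<close>

definition wdeg :: "'v set \<Rightarrow> ('v set \<Rightarrow> real) \<Rightarrow> 'v set \<Rightarrow> real" where
  "wdeg A w T = (\<Sum>f | f \<subseteq> A \<and> T \<subseteq> f. w f)"

definition windep :: "('v set \<Rightarrow> real) \<Rightarrow> 'v set \<Rightarrow> bool" where
  "windep w I \<longleftrightarrow> (\<forall>f. f \<subseteq> I \<longrightarrow> w f = 0)"

lemma wdeg_mono:
  assumes "finite A" "\<And>f. w f \<le> w' f"
  shows "wdeg A w T \<le> wdeg A w' T"
  unfolding wdeg_def by (intro sum_mono assms)

lemma wdeg_as_indicator_sum:
  assumes "finite A"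
  shows "wdeg A w T = (\<Sum>f\<in>Pow A. if T \<subseteq> f then w f else 0)"
proof -
  have "{f. f \<subseteq> A \<and> T \<subseteq> f} = Pow A \<inter> {f. T \<subseteq> f}" by auto
  then show ?thesis
    using assms by (simp add: wdeg_def sum.inter_restrict)
qed

text \<open>Double counting: the weight of \<open>f\<close> is counted once for every member of
  \<open>\<T>\<close> inside \<open>f\<close>.\<close>

lemma sum_wdeg_swap:
  assumes "finite A" "finite \<T>"
  shows "(\<Sum>T\<in>\<T>. wdeg A w T) = (\<Sum>f\<in>Pow A. w f * real (card {T \<in> \<T>. T \<subseteq> f}))"
proof -
  have "(\<Sum>T\<in>\<T>. wdeg A w T) = (\<Sum>f\<in>Pow A. \<Sum>T\<in>\<T>. if T \<subseteq> f then w f else 0)"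
    unfolding wdeg_as_indicator_sum[OF assms(1)] by (rule sum.swap)
  also have "\<dots> = (\<Sum>f\<in>Pow A. w f * real (card {T \<in> \<T>. T \<subseteq> f}))"
  proof (intro sum.cong refl)
    fix f
    have "(\<Sum>T\<in>\<T>. if T \<subseteq> f then w f else 0) = (\<Sum>T\<in>{T \<in> \<T>. T \<subseteq> f}. w f)"
      using assms(2) by (intro sum.mono_neutral_cong_right) auto
    then show "(\<Sum>T\<in>\<T>. if T \<subseteq> f then w f else 0) = w f * real (card {T \<in> \<T>. T \<subseteq> f})"
      by simp
  qed
  finally show ?thesis .
qed

lemma sum_singleton_wdeg_swap:
  assumes "finite A"
  shows "(\<Sum>v\<in>A. wdeg A w {v}) = (\<Sum>f\<in>Pow A. w f * real (card f))"
proof -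
  have "(\<Sum>v\<in>A. wdeg A w {v}) = (\<Sum>T\<in>(\<lambda>v. {v}) ` A. wdeg A w T)"
    by (simp add: sum.reindex)
  also have "\<dots> = (\<Sum>f\<in>Pow A. w f * real (card {T \<in> (\<lambda>v. {v}) ` A. T \<subseteq> f}))"
    using assms by (intro sum_wdeg_swap) auto
  also have "\<dots> = (\<Sum>f\<in>Pow A. w f * real (card f))"
  proof (intro sum.cong refl)
    fix f assume "f \<in> Pow A"
    then have "{T \<in> (\<lambda>v. {v}) ` A. T \<subseteq> f} = (\<lambda>v. {v}) ` f" by auto
    then show "w f * real (card {T \<in> (\<lambda>v. {v}) ` A. T \<subseteq> f}) = w f * real (card f)"
      by (simp add: card_image)
  qed
  finally show ?thesis .
qed

text \<open>Bounds the number of fingerprints, that is, of the short lists of picked vertices that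
  determine the containers.\<close>

lemma card_lists_length_le_power:
  assumes "finite A"
  shows "card {xs. set xs \<subseteq> A \<and> length xs \<le> b} \<le> (card A + 1) ^ b"
proof -
  have "(\<Sum>i\<le>b. c ^ i) \<le> (c + 1) ^ b" for c :: nat
  proof (induction b)
    case (Suc b)
    have "c ^ Suc b \<le> c * (c + 1) ^ b"
      by (simp add: power_mono)
    with Suc show ?case by (simp only: sum.atMost_Suc power_Suc distrib_right mult_1 add_mono add.commute)
  qed simp
  then show ?thesis
    using assms by (simp add: card_lists_length_le)
qed

text \<open>Both functions depend on the hypergraph only through the list of vertices picked so far (most
  recent first). This is why every container is determined by a short list of vertices.\<close>

definition pruned ::
  "'v set \<Rightarrow> ('v set \<Rightarrow> real) \<Rightarrow> (nat \<Rightarrow> real) \<Rightarrow> ('v set \<Rightarrow> real) \<Rightarrow> 'v set \<Rightarrow> 'v set \<Rightarrow> real" where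
  "pruned A w \<tau> u X f =
     (if f \<inter> X = {} \<and> (\<forall>T. T \<noteq> {} \<and> T \<subseteq> f \<longrightarrow> wdeg A u T < \<tau> (card T)) then w f else 0)"

primrec link ::
  "'v set \<Rightarrow> ('v set \<Rightarrow> real) \<Rightarrow> (nat \<Rightarrow> real) \<Rightarrow> 'v list \<Rightarrow> 'v set \<Rightarrow> real" where
  "link A w \<tau> [] = (\<lambda>f. 0)"
| "link A w \<tau> (v # L) = (\<lambda>f. link A w \<tau> L f +
     (if v \<in> f then 0 else pruned A w \<tau> (link A w \<tau> L) (set L) (insert v f)))"

section \<open>Covering families of containers\<close>

definition has_containers ::
  "'v set \<Rightarrow> ('v set \<Rightarrow> bool) \<Rightarrow> ('v set \<Rightarrow> bool) \<Rightarrow> real \<Rightarrow> bool" where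
  "has_containers A P Q M \<longleftrightarrow> (\<exists>\<C>. finite \<C> \<and> real (card \<C>) \<le> M \<and>
     (\<forall>C\<in>\<C>. C \<subseteq> A \<and> Q C) \<and> (\<forall>I. I \<subseteq> A \<and> P I \<longrightarrow> (\<exists>C\<in>\<C>. I \<subseteq> C)))"

lemma has_containersI:
  assumes "finite \<C>" "real (card \<C>) \<le> M" "\<And>C. C \<in> \<C> \<Longrightarrow> C \<subseteq> A \<and> Q C"
    and "\<And>I. I \<subseteq> A \<Longrightarrow> P I \<Longrightarrow> \<exists>C\<in>\<C>. I \<subseteq> C"
  shows "has_containers A P Q M"
  unfolding has_containers_def
  by (intro exI[of _ \<C>] conjI ballI allI impI) (use assms in auto)

lemma has_containers_mono:
  assumes "has_containers A P Q M" "\<And>I. I \<subseteq> A \<Longrightarrow> P' I \<Longrightarrow> P I"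
  shows "has_containers A P' Q M"
proof -
  from assms(1) obtain \<C> where "finite \<C>" "real (card \<C>) \<le> M" "\<forall>C\<in>\<C>. C \<subseteq> A \<and> Q C"
    "\<forall>I. I \<subseteq> A \<and> P I \<longrightarrow> (\<exists>C\<in>\<C>. I \<subseteq> C)"
    unfolding has_containers_def by (elim exE conjE) (rule that)
  with assms(2) show ?thesis by (intro has_containersI[of \<C>]) simp_all
qed

text \<open>Composes covers in two ways. In \<open>container_step\<close> the index is the list of
  picked vertices and all \<open>A L\<close> coincide; in \<open>iterate_containers\<close> the
  index is a container of the previous round and \<open>A L\<close> is that container
  itself.\<close>

lemma has_containers_UN:
  fixes M :: real
  assumes "finite \<L>" "\<And>L. L \<in> \<L> \<Longrightarrow> has_containers (A L) (P L) Q M"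
    and "\<And>L. L \<in> \<L> \<Longrightarrow> A L \<subseteq> B" "real (card \<L>) \<le> m" "0 \<le> M"
    and "\<And>I. I \<subseteq> B \<Longrightarrow> P' I \<Longrightarrow> \<exists>L\<in>\<L>. I \<subseteq> A L \<and> P L I"
  shows "has_containers B P' Q (m * M)"
proof -
  have "\<forall>L\<in>\<L>. \<exists>\<C>. finite \<C> \<and> real (card \<C>) \<le> M \<and>
     (\<forall>C\<in>\<C>. C \<subseteq> A L \<and> Q C) \<and> (\<forall>I. I \<subseteq> A L \<and> P L I \<longrightarrow> (\<exists>C\<in>\<C>. I \<subseteq> C))"
    using assms(2) by (simp add: has_containers_def)
  from bchoice[OF this] obtain \<F> where \<F>: "\<forall>L\<in>\<L>. finite (\<F> L) \<and> real (card (\<F> L)) \<le> M \<and>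
     (\<forall>C\<in>\<F> L. C \<subseteq> A L \<and> Q C) \<and> (\<forall>I. I \<subseteq> A L \<and> P L I \<longrightarrow> (\<exists>C\<in>\<F> L. I \<subseteq> C))" ..
  show ?thesis
  proof (rule has_containersI)
    show "finite (\<Union>L\<in>\<L>. \<F> L)" using assms(1) \<F> by blast
    have "real (card (\<Union>L\<in>\<L>. \<F> L)) \<le> (\<Sum>L\<in>\<L>. real (card (\<F> L)))"
      using card_UN_le[OF assms(1), of \<F>] by (simp flip: of_nat_sum)
    also have "\<dots> \<le> (\<Sum>L\<in>\<L>. M)"
      using \<F> by (intro sum_mono) auto
    also have "\<dots> \<le> m * M"
      using assms(4,5) by (simp add: mult_right_mono)
    finally show "real (card (\<Union>L\<in>\<L>. \<F> L)) \<le> m * M" .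
  next
    fix C assume "C \<in> (\<Union>L\<in>\<L>. \<F> L)"
    then obtain L where "L \<in> \<L>" "C \<in> \<F> L" by blast
    with \<F> assms(3) show "C \<subseteq> B \<and> Q C" by (meson subset_trans)
  next
    fix I assume "I \<subseteq> B" "P' I"
    then obtain L where "L \<in> \<L>" "I \<subseteq> A L" "P L I" using assms(6) by blast
    with \<F> show "\<exists>C\<in>(\<Union>L\<in>\<L>. \<F> L). I \<subseteq> C" by (meson UN_I)
  qed
qed

section \<open>One round of picking heavy vertices\<close>

text \<open>Degrees are measured in units of total weight over \<open>N\<close>, and each further
  vertex of \<open>T\<close> gains a factor \<open>q\<close>. The scale \<open>N\<close> is separate
  from \<open>card A\<close>, so the parameters can stay fixed while the vertex set shrinks. The
  number \<open>b\<close> will be the number of picks.\<close>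

locale spread_hypergraph =
  fixes A :: "'v set" and w :: "'v set \<Rightarrow> real" and i :: nat and K q N :: real and b :: nat
  assumes fin: "finite A"
    and w_nonneg: "0 \<le> w f"
    and unif: "w f \<noteq> 0 \<Longrightarrow> f \<subseteq> A \<and> card f = i"
    and N_pos: "0 < N" and card_A: "real (card A) \<le> N"
    and q_def: "q = real b / N" and b_pos: "1 \<le> b"
    and K_ge: "1 \<le> K"
    and total_pos: "0 < wdeg A w {}"
    and spread: "T \<subseteq> A \<Longrightarrow> T \<noteq> {} \<Longrightarrow> wdeg A w T \<le> K * q ^ (card T - 1) * wdeg A w {} / N"
begin

text \<open>The size of \<open>K'\<close> ensures that the edges of \<open>w\<close> containing a saturated set, one whose degree in the
  link hypergraph has reached the threshold \<open>\<tau>\<close>, have total weight at most \<open>e / 4\<close>.\<close>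

definition "e \<equiv> wdeg A w {}"
definition "K' \<equiv> 2 ^ i * 4 * K\<^sup>2"
text \<open>A link collected from \<open>b\<close> heavy vertices has weight of order
  \<open>q * e\<close>, so \<open>q ^ t * e / N\<close> is the unit
  \<open>q ^ (t - 1) * (q * e) / N\<close> in which the next round measures spread.\<close>

definition "\<tau> \<equiv> \<lambda>t. K' * q ^ t * e / N"
definition "lk \<equiv> link A w \<tau>"
definition "pr L \<equiv> pruned A w \<tau> (lk L) (set L)"

lemma q_pos: "0 < q"
  using q_def b_pos N_pos by simp

lemma e_pos: "0 < e"
  using total_pos by (simp add: e_def)

lemma K'_pos: "0 < K'"
  using K_ge by (simp add: K'_def)

lemma \<tau>_pos: "0 < \<tau> t"
  using K'_pos q_pos e_pos N_pos by (simp add: \<tau>_def)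

lemma spread': "T \<subseteq> A \<Longrightarrow> T \<noteq> {} \<Longrightarrow> wdeg A w T \<le> K * q ^ (card T - 1) * e / N"
  using spread by (simp add: e_def)

lemma lk_Nil: "lk [] f = 0"
  by (simp add: lk_def)

lemma lk_Cons: "lk (v # L) f = lk L f + (if v \<in> f then 0 else pr L (insert v f))"
  by (simp add: lk_def pr_def)

lemma pr_nonneg: "0 \<le> pr L f"
  by (simp add: pr_def pruned_def w_nonneg)

lemma pr_le: "pr L f \<le> w f"
  by (simp add: pr_def pruned_def w_nonneg)

lemma pr_support: "pr L f \<noteq> 0 \<Longrightarrow> w f \<noteq> 0 \<and> f \<inter> set L = {}"
  by (auto simp: pr_def pruned_def split: if_splits)

lemma lk_nonneg: "0 \<le> lk L f"
  by (induction L) (auto simp: lk_Nil lk_Cons pr_nonneg)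

lemma lk_unif: "lk L f \<noteq> 0 \<Longrightarrow> f \<subseteq> A \<and> Suc (card f) = i"
proof (induction L)
  case (Cons v L)
  show ?case
  proof (cases "lk L f = 0")
    case True
    with Cons.prems have v: "v \<notin> f" and "pr L (insert v f) \<noteq> 0"
      by (auto simp: lk_Cons split: if_splits)
    then have "w (insert v f) \<noteq> 0" using pr_support by blast
    then have "insert v f \<subseteq> A" "card (insert v f) = i" using unif by auto
    moreover have "finite f" using calculation(1) fin finite_subset by auto
    ultimately show ?thesis using v by simp
  qed (use Cons.IH in auto)
qed (simp add: lk_Nil)

text \<open>This lets the induction on the uniformity continue: all picks lie in \<open>I\<close>,
  so an edge of the link inside \<open>I\<close> would extend by a pick to an edge of
  \<open>w\<close> inside \<open>I\<close>.\<close>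

lemma lk_windep:
  assumes "windep w I" "set L \<subseteq> I"
  shows "windep (lk L) I"
  using assms(2)
proof (induction L)
  case (Cons v L)
  have "pr L (insert v f) = 0" if "f \<subseteq> I" for f
  proof -
    have "w (insert v f) = 0"
      using assms(1) that Cons.prems by (auto simp: windep_def)
    then show ?thesis using pr_support by blast
  qed
  with Cons show ?case by (simp add: windep_def lk_Cons)
qed (simp add: windep_def lk_Nil)

text \<open>The part of the link added for \<open>v\<close> lives on sets avoiding \<open>v\<close>.
  Inserting \<open>v\<close> matches those that contain \<open>T\<close> with the sets containing
  \<open>insert v T\<close>.\<close>

lemma wdeg_lk_Cons:
  assumes "v \<in> A"
  shows "wdeg A (lk (v # L)) T = wdeg A (lk L) T + (if v \<in> T then 0 else wdeg A (pr L) (insert v T))"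
proof -
  have "(\<Sum>f | f \<subseteq> A \<and> T \<subseteq> f. if v \<in> f then 0 else pr L (insert v f)) =
        (if v \<in> T then 0 else wdeg A (pr L) (insert v T))" (is "?S = _")
  proof (cases "v \<in> T")
    case True
    then have "?S = 0" by (intro sum.neutral) auto
    with True show ?thesis by simp
  next
    case False
    have "?S = (\<Sum>f | f \<subseteq> A \<and> T \<subseteq> f \<and> v \<notin> f. pr L (insert v f))"
      using fin by (intro sum.mono_neutral_cong_right) (auto intro: finite_subset[of _ "Pow A"])
    also have "\<dots> = (\<Sum>f | f \<subseteq> A \<and> insert v T \<subseteq> f. pr L f)"
      using assms False
      by (intro sum.reindex_bij_witness[of _ "\<lambda>f. f - {v}" "insert v"]) (auto simp: insert_absorb)
    finally show ?thesis using False by (simp add: wdeg_def)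
  qed
  then show ?thesis
    by (simp add: wdeg_def lk_Cons sum.distrib)
qed

lemma wdeg_pr_insert_le:
  assumes "v \<in> A" "T \<subseteq> A" "v \<notin> T"
  shows "wdeg A (pr L) (insert v T) \<le> K * q ^ card T * e / N"
proof -
  have "wdeg A (pr L) (insert v T) \<le> wdeg A w (insert v T)"
    using fin pr_le by (intro wdeg_mono)
  also have "\<dots> \<le> K * q ^ (card (insert v T) - 1) * e / N"
    using assms by (intro spread') auto
  also have "card (insert v T) - 1 = card T"
    using assms fin finite_subset[of T A] by simp
  finally show ?thesis .
qed

text \<open>Once \<open>T\<close> is saturated, no remaining edge contains it, so the degree of \<open>T\<close> overshoots
  its threshold by at most one increment.\<close>

lemma wdeg_lk_le:
  assumes "set L \<subseteq> A" "T \<subseteq> A" "T \<noteq> {}"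
  shows "wdeg A (lk L) T \<le> \<tau> (card T) + K * q ^ card T * e / N"
  using assms(1)
proof (induction L)
  case Nil
  have "0 \<le> \<tau> (card T) + K * q ^ card T * e / N"
    using \<tau>_pos[of "card T"] K_ge q_pos e_pos N_pos by simp
  then show ?case by (simp add: wdeg_def lk_Nil)
next
  case (Cons v L)
  then have v: "v \<in> A" by simp
  consider "v \<in> T" | "v \<notin> T" "\<tau> (card T) \<le> wdeg A (lk L) T" | "v \<notin> T" "wdeg A (lk L) T < \<tau> (card T)"
    by linarith
  then show ?case
  proof cases
    case 2
    then have "pr L f = 0" if "insert v T \<subseteq> f" for f
      using that assms(3) by (auto simp: pr_def pruned_def)
    then have "wdeg A (pr L) (insert v T) = 0"
      by (simp add: wdeg_def)
    with Cons v show ?thesis by (simp add: wdeg_lk_Cons)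
  next
    case 3
    with Cons v assms wdeg_pr_insert_le[of v T L] show ?thesis
      by (simp add: wdeg_lk_Cons)
  qed (use Cons v in \<open>simp add: wdeg_lk_Cons\<close>)
qed

text \<open>Every pick adds its degree in the pruned hypergraph, which the spread condition bounds
  by \<open>K * e / N\<close>.\<close>

lemma total_lk_le:
  assumes "set L \<subseteq> A"
  shows "wdeg A (lk L) {} \<le> length L * (K * e / N)"
  using assms
proof (induction L)
  case (Cons v L)
  with wdeg_pr_insert_le[of v "{}" L] show ?case
    by (simp add: wdeg_lk_Cons algebra_simps add_divide_distrib)
qed (simp add: wdeg_def lk_Nil)

text \<open>Edges meeting the at most \<open>b\<close> picks weigh at most \<open>K * q * e\<close>,
  hence at most \<open>e / 4\<close>. A saturated set has large link degree, while the whole link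
  weighs at most \<open>K * q * e\<close> and each of its edges has at most \<open>2 ^ i\<close>
  subsets; so the edges over saturated sets weigh at most \<open>e / 4\<close> too.\<close>

lemma total_pr_ge:
  assumes "set L \<subseteq> A" "length L \<le> b" "q \<le> 1 / (4 * K)"
  shows "e / 2 \<le> wdeg A (pr L) {}"
proof -
  define S where "S = {T. T \<subseteq> A \<and> T \<noteq> {} \<and> \<tau> (card T) \<le> wdeg A (lk L) T}"
  have finS: "finite S" using fin by (auto simp: S_def)
  \<comment> \<open>A deleted edge is charged to a pick in it or to a saturated subset of it;
    charging it more than once only lowers the left side.\<close>
  have pt: "w f - (\<Sum>v\<in>set L. if {v} \<subseteq> f then w f else 0) - (\<Sum>T\<in>S. if T \<subseteq> f then w f else 0)
      \<le> pr L f" if "f \<in> Pow A" for f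
  proof -
    have nn: "0 \<le> (\<Sum>v\<in>set L. if {v} \<subseteq> f then w f else 0)" "0 \<le> (\<Sum>T\<in>S. if T \<subseteq> f then w f else 0)"
      by (intro sum_nonneg; simp add: w_nonneg)+
    show ?thesis
    proof (cases "pr L f = w f")
      case False
      then have "f \<inter> set L \<noteq> {} \<or> (\<exists>T. T \<noteq> {} \<and> T \<subseteq> f \<and> \<tau> (card T) \<le> wdeg A (lk L) T)"
        unfolding pr_def pruned_def by (meson not_less)
      then have "(\<exists>v. v \<in> set L \<and> v \<in> f) \<or> (\<exists>T. T \<in> S \<and> T \<subseteq> f)"
      proof (elim disjE exE conjE)
        fix T assume "T \<noteq> {}" "T \<subseteq> f" "\<tau> (card T) \<le> wdeg A (lk L) T"
        with that have "T \<in> S" by (simp add: S_def subset_trans)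
        with \<open>T \<subseteq> f\<close> show ?thesis by blast
      qed blast
      then consider v where "v \<in> set L" "v \<in> f" | T where "T \<in> S" "T \<subseteq> f"
        by blast
      then have "w f \<le> (\<Sum>v\<in>set L. if {v} \<subseteq> f then w f else 0) + (\<Sum>T\<in>S. if T \<subseteq> f then w f else 0)"
      proof cases
        case 1
        then have "w f \<le> (\<Sum>v\<in>set L. if {v} \<subseteq> f then w f else 0)"
          using member_le_sum[of v "set L" "\<lambda>v. if {v} \<subseteq> f then w f else 0"] by (simp add: w_nonneg)
        with nn show ?thesis by linarith
      next
        case 2
        then have "w f \<le> (\<Sum>T\<in>S. if T \<subseteq> f then w f else 0)"
          using member_le_sum[of T S "\<lambda>T. if T \<subseteq> f then w f else 0"] finS by (simp add: w_nonneg)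
        with nn show ?thesis by linarith
      qed
      with pr_nonneg[of L f] show ?thesis by linarith
    qed (use nn in linarith)
  qed
  have "e - (\<Sum>v\<in>set L. wdeg A w {v}) - (\<Sum>T\<in>S. wdeg A w T) =
     (\<Sum>f\<in>Pow A. w f - (\<Sum>v\<in>set L. if {v} \<subseteq> f then w f else 0) - (\<Sum>T\<in>S. if T \<subseteq> f then w f else 0))"
    unfolding e_def wdeg_as_indicator_sum[OF fin] sum_subtractf
    by (subst (2 4) sum.swap) simp
  also have "\<dots> \<le> (\<Sum>f\<in>Pow A. pr L f)"
    by (rule sum_mono) (rule pt)
  also have "\<dots> = wdeg A (pr L) {}"
    by (simp add: wdeg_as_indicator_sum[OF fin])
  finally have main: "e - (\<Sum>v\<in>set L. wdeg A w {v}) - (\<Sum>T\<in>S. wdeg A w T) \<le> wdeg A (pr L) {}" .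
  have len: "length L * (K * e / N) \<le> K * q * e"
  proof -
    have "length L * (K * e / N) \<le> b * (K * e / N)"
      using assms(2) K_ge e_pos N_pos by (intro mult_right_mono) auto
    then show ?thesis by (simp add: q_def mult_ac)
  qed
  have "(\<Sum>v\<in>set L. wdeg A w {v}) \<le> (\<Sum>v\<in>set L. K * e / N)"
    using assms(1) spread'[of "{_}"] by (intro sum_mono) auto
  also have "\<dots> \<le> length L * (K * e / N)"
    using K_ge e_pos N_pos by (simp only: sum_constant, intro mult_right_mono) (auto simp: card_length)
  also note len
  also have "K * q * e \<le> e / 4"
    using assms(3) K_ge e_pos by (simp add: field_simps)
  finally have 1: "(\<Sum>v\<in>set L. wdeg A w {v}) \<le> e / 4" .
  \<comment> \<open>The factor \<open>K / (K' * q)\<close> is the ratio of the spread bound to the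
    threshold \<open>\<tau>\<close>, which the link degree of a saturated set reaches.\<close>
  have "(\<Sum>T\<in>S. wdeg A w T) \<le> (\<Sum>T\<in>S. K / (K' * q) * wdeg A (lk L) T)"
  proof (rule sum_mono)
    fix T assume T: "T \<in> S"
    then have cT: "card T \<noteq> 0"
      using fin finite_subset[of T A] by (simp add: S_def)
    have "wdeg A w T \<le> K * q ^ (card T - 1) * e / N"
      using T spread' by (auto simp: S_def)
    also have "\<dots> = K / (K' * q) * \<tau> (card T)"
      using cT K'_pos q_pos by (cases "card T") (auto simp: \<tau>_def)
    also have "\<dots> \<le> K / (K' * q) * wdeg A (lk L) T"
      using T K_ge K'_pos q_pos by (intro mult_left_mono) (auto simp: S_def)
    finally show "wdeg A w T \<le> K / (K' * q) * wdeg A (lk L) T" .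
  qed
  also have "\<dots> = K / (K' * q) * (\<Sum>f\<in>Pow A. lk L f * real (card {T \<in> S. T \<subseteq> f}))"
    by (simp only: sum_distrib_left[symmetric] sum_wdeg_swap[OF fin finS])
  also have "\<dots> \<le> K / (K' * q) * (\<Sum>f\<in>Pow A. lk L f * 2 ^ i)"
  proof (rule mult_left_mono, rule sum_mono)
    fix f assume f: "f \<in> Pow A"
    show "lk L f * real (card {T \<in> S. T \<subseteq> f}) \<le> lk L f * 2 ^ i"
    proof (cases "lk L f = 0")
      case False
      have finf: "finite f" using f fin finite_subset by auto
      have "card {T \<in> S. T \<subseteq> f} \<le> card (Pow f)"
        using finf by (intro card_mono) auto
      also have "\<dots> \<le> 2 ^ i"
        using lk_unif[OF False] finf by (auto simp: card_Pow intro!: power_increasing)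
      finally have "real (card {T \<in> S. T \<subseteq> f}) \<le> 2 ^ i"
        using of_nat_mono by fastforce
      then show ?thesis by (intro mult_left_mono lk_nonneg)
    qed simp
  qed (use K_ge K'_pos q_pos in auto)
  also have "(\<Sum>f\<in>Pow A. lk L f * 2 ^ i) = 2 ^ i * wdeg A (lk L) {}"
    by (simp add: wdeg_as_indicator_sum[OF fin] sum_distrib_left mult.commute)
  also have "K / (K' * q) * (2 ^ i * wdeg A (lk L) {}) \<le> K / (K' * q) * (2 ^ i * (K * q * e))"
    using total_lk_le[OF assms(1)] len K_ge K'_pos q_pos by (intro mult_left_mono) auto
  also have "\<dots> = e / 4"
    using K_ge q_pos by (simp add: K'_def power2_eq_square)
  finally have "(\<Sum>T\<in>S. wdeg A w T) \<le> e / 4" .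
  with main 1 show ?thesis by linarith
qed

text \<open>Each pick is tested against the hypergraph pruned by the picks before it. With the
  cutoff \<open>e / (4 * N)\<close>, light vertices carry at most \<open>e / 4\<close> of the degree
  sum, which for positive uniformity is at least \<open>e / 2\<close>.\<close>

primrec heavy :: "'v list \<Rightarrow> bool" where
  "heavy [] \<longleftrightarrow> True"
| "heavy (v # L) \<longleftrightarrow> heavy L \<and> e / (4 * N) \<le> wdeg A (pr L) {v}"

definition "light L = {v \<in> A. wdeg A (pr L) {v} < e / (4 * N)}"

text \<open>For \<open>b\<close> heavy picks the bound is \<open>q * e / 4\<close>. Relative to such
  a weight the degree bounds of the link are again a spread condition.\<close>

lemma total_lk_ge:
  assumes "heavy L" "set L \<subseteq> A"
  shows "length L * (e / (4 * N)) \<le> wdeg A (lk L) {}"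
  using assms
proof (induction L)
  case (Cons v L)
  then show ?case by (simp add: wdeg_lk_Cons algebra_simps add_divide_distrib)
qed (simp add: lk_Nil wdeg_def)

text \<open>The degree sum after pruning is at least \<open>e / 2\<close>, and light vertices carry
  at most \<open>e / 4\<close> of it. The rest sits on vertices of degree at most
  \<open>K * e / N\<close>, so at least \<open>N / (4 * K)\<close> vertices are not light.\<close>

lemma card_light:
  assumes "set L \<subseteq> A" "length L \<le> b" "q \<le> 1 / (4 * K)" and i_pos: "0 < i"
  shows "real (card (light L)) \<le> real (card A) - N / (4 * K)"
proof -
  have "e / 2 \<le> wdeg A (pr L) {}" by (rule total_pr_ge[OF assms(1-3)])
  also have "\<dots> = (\<Sum>f\<in>Pow A. pr L f)" by (simp add: wdeg_as_indicator_sum[OF fin])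
  also have "\<dots> \<le> (\<Sum>f\<in>Pow A. pr L f * real (card f))"
  proof (rule sum_mono)
    fix f
    show "pr L f \<le> pr L f * real (card f)"
    proof (cases "pr L f = 0")
      case False
      then have "card f = i" using pr_support unif by blast
      then show ?thesis using i_pos pr_nonneg[of L f] by (simp add: mult_le_cancel_left1)
    qed simp
  qed
  also have "\<dots> = (\<Sum>v\<in>A. wdeg A (pr L) {v})"
    by (simp add: sum_singleton_wdeg_swap[OF fin])
  also have "\<dots> = (\<Sum>v\<in>light L. wdeg A (pr L) {v}) + (\<Sum>v\<in>A - light L. wdeg A (pr L) {v})"
    using fin by (subst sum.subset_diff[of "light L" A]) (auto simp: light_def)
  also have "(\<Sum>v\<in>light L. wdeg A (pr L) {v}) \<le> (\<Sum>v\<in>A. e / (4 * N))"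
  proof -
    have "(\<Sum>v\<in>light L. wdeg A (pr L) {v}) \<le> (\<Sum>v\<in>light L. e / (4 * N))"
      by (intro sum_mono) (auto simp: light_def)
    also have "\<dots> \<le> (\<Sum>v\<in>A. e / (4 * N))"
      using fin e_pos N_pos by (intro sum_mono2) (auto simp: light_def)
    finally show ?thesis .
  qed
  also have "\<dots> \<le> e / 4"
    using card_A N_pos e_pos by (simp add: field_simps)
  also have "(\<Sum>v\<in>A - light L. wdeg A (pr L) {v}) \<le> (\<Sum>v\<in>A - light L. K * e / N)"
    using wdeg_pr_insert_le[of _ "{}" L] by (intro sum_mono) auto
  also have "\<dots> = real (card (A - light L)) * (K * e / N)" by simp
  finally have "e / 2 \<le> e / 4 + real (card (A - light L)) * (K * e / N)" by simp
  then have "e / 4 \<le> real (card (A - light L)) * (K * e / N)" by linarith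
  then have "N / (4 * K) \<le> real (card (A - light L))"
    using e_pos N_pos K_ge by (simp add: field_simps)
  moreover have "real (card (A - light L)) = real (card A) - real (card (light L))"
    using fin by (subst card_Diff_subset) (auto simp: light_def of_nat_diff card_mono finite_subset)
  ultimately show ?thesis by linarith
qed

text \<open>Greedy choice: as long as \<open>I\<close> is not inside \<open>light L\<close>, some
  vertex of \<open>I\<close> is heavy and can be put in front of \<open>L\<close>.\<close>

lemma heavy_list_exists:
  assumes "I \<subseteq> A"
  shows "\<exists>L. set L \<subseteq> I \<and> heavy L \<and> (length L = m \<or> length L < m \<and> I \<subseteq> light L)"
proof (induction m)
  case (Suc m)
  then obtain L where L: "set L \<subseteq> I" "heavy L" "length L = m \<or> length L < m \<and> I \<subseteq> light L"
    by blast
  show ?case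
  proof (cases "I \<subseteq> light L")
    case False
    then obtain v where "v \<in> I" "v \<notin> light L" by blast
    with L False assms have "set (v # L) \<subseteq> I" "heavy (v # L)" "length (v # L) = Suc m"
      by (auto simp: light_def)
    then show ?thesis by blast
  qed (use L in auto)
qed (intro exI[of _ "[]"], simp)

end

section \<open>The container theorem and its iteration\<close>

text \<open>Induction on the uniformity. Greedy picking from an independent set either stops early,
  and then \<open>light L\<close> contains it, or yields a spread link of lower uniformity in which
  the set is still independent. The constants \<open>\<delta>\<close> and \<open>q0\<close> depend
  on \<open>i\<close> and \<open>K\<close> alone, which permits iteration with fixed losses.\<close>

lemma container_step:
  fixes K :: real
  assumes "1 \<le> K"
  shows "\<exists>\<delta>>0. \<exists>q0>0. \<forall>(A :: 'v set) w q N b. spread_hypergraph A w i K q N b \<longrightarrow> q \<le> q0 \<longrightarrow>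
     has_containers A (windep w) (\<lambda>C. real (card C) \<le> real (card A) - \<delta> * N) ((2 * (N + 1) ^ b) ^ i)"
  using assms
proof (induction i arbitrary: K)
  case 0
  \<comment> \<open>In uniformity 0 positive total weight forces the empty set to be an edge. Then
    no set is independent and the empty family of containers suffices.\<close>
  have "has_containers A (windep w) (\<lambda>C. real (card C) \<le> real (card A) - 1 * N) ((2 * (N + 1) ^ b) ^ 0)"
    if "spread_hypergraph A w 0 K q N b" for A :: "'v set" and w q N b
  proof -
    interpret spread_hypergraph A w 0 K q N b by (rule that)
    have "\<not> windep w I" for I
    proof
      assume "windep w I"
      then have 0: "w {} = 0" by (simp add: windep_def)
      have "w f = 0" for f
      proof (rule ccontr)
        assume f: "w f \<noteq> 0"
        then have "f = {}" using unif[OF f] fin finite_subset[of f A] by simp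
        with f 0 show False by simp
      qed
      then show False using total_pos by (simp add: wdeg_def)
    qed
    then show ?thesis by (intro has_containersI[of "{}"]) auto
  qed
  then show ?case
    by (intro exI[of _ "1::real"] conjI allI impI) auto
next
  case (Suc i)
  \<comment> \<open>Link degrees are at most \<open>2 * K' * q ^ t * e / N\<close>, and after
    \<open>b\<close> heavy picks the link weighs at least \<open>q * e / 4\<close>; together the
    constants give \<open>8 * K'\<close>.\<close>
  define K2 where "K2 = 8 * (2 ^ Suc i * 4 * K\<^sup>2)"
  have one2: "(1 :: real) \<le> 2 ^ Suc i" by (rule one_le_power) simp
  have "1 \<le> K\<^sup>2" using Suc.prems by simp
  with one2 have "1 * 1 \<le> 2 ^ Suc i * K\<^sup>2" by (intro mult_mono) auto
  then have K2: "1 \<le> K2" by (simp add: K2_def)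
  obtain \<delta>' q' where \<delta>': "0 < \<delta>'" and q': "0 < q'" and IH':
    "\<forall>(A :: 'v set) w q N b. spread_hypergraph A w i K2 q N b \<longrightarrow> q \<le> q' \<longrightarrow>
     has_containers A (windep w) (\<lambda>C. real (card C) \<le> real (card A) - \<delta>' * N) ((2 * (N + 1) ^ b) ^ i)"
    using Suc.IH[OF K2] by (elim exE conjE) (erule (2) that)
  note IH = IH'[rule_format]
  define \<delta> where "\<delta> = min \<delta>' (1 / (4 * K))"
  define q0 where "q0 = min q' (1 / (4 * K))"
  have \<delta>: "0 < \<delta>" and q0: "0 < q0"
    using \<delta>' q' Suc.prems by (auto simp: \<delta>_def q0_def)
  have "has_containers A (windep w) (\<lambda>C. real (card C) \<le> real (card A) - \<delta> * N)
      ((2 * (N + 1) ^ b) ^ Suc i)"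
    if hyp: "spread_hypergraph A w (Suc i) K q N b" and "q \<le> q0"
    for A :: "'v set" and w q N b
  proof -
    interpret spread_hypergraph A w "Suc i" K q N b by (rule hyp)
    have q1: "q \<le> q'" and q2: "q \<le> 1 / (4 * K)" using \<open>q \<le> q0\<close> by (auto simp: q0_def)
    have \<delta>N: "\<delta> * N \<le> \<delta>' * N" "\<delta> * N \<le> 1 / (4 * K) * N"
      using N_pos by (intro mult_right_mono; simp add: \<delta>_def)+
    define \<L> where "\<L> = {L. set L \<subseteq> A \<and> length L \<le> b}"
    have fin\<L>: "finite \<L>" using fin finite_lists_length_le by (simp add: \<L>_def)
    have "1 \<le> (N + 1) ^ b" using N_pos by (intro one_le_power) auto
    then have one: "1 \<le> (2 * (N + 1) ^ b) ^ i" by (intro one_le_power) linarith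
    have "K \<le> K'"
    proof -
      have "1 * K \<le> K * K" using K_ge by (intro mult_right_mono) auto
      moreover have "1 * K\<^sup>2 \<le> 2 ^ Suc i * 4 * K\<^sup>2"
        using one2 by (intro mult_right_mono) auto
      ultimately show ?thesis by (simp add: K'_def power2_eq_square)
    qed
    \<comment> \<open>The sets for which \<open>L\<close> is responsible: either
      \<open>light L\<close> is already a container, or the induction hypothesis is applied to the
      link of \<open>b\<close> heavy picks.\<close>
    define P where "P L I \<longleftrightarrow> I \<subseteq> light L \<or> heavy L \<and> length L = b \<and> windep (lk L) I" for L I
    have P: "has_containers A (P L) (\<lambda>C. real (card C) \<le> real (card A) - \<delta> * N)
        (2 * (2 * (N + 1) ^ b) ^ i)" if "L \<in> \<L>" for L
    proof -
      have L: "set L \<subseteq> A" "length L \<le> b" using that by (auto simp: \<L>_def)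
      have light: "light L \<subseteq> A \<and> real (card (light L)) \<le> real (card A) - \<delta> * N"
        using card_light[OF L q2] \<delta>N(2) by (auto simp: light_def)
      show ?thesis
      proof (cases "heavy L \<and> length L = b")
        case False
        with light one show ?thesis
          by (intro has_containersI[of "{light L}"]) (auto simp: P_def)
      next
        case True
        have "has_containers A (windep (lk L)) (\<lambda>C. real (card C) \<le> real (card A) - \<delta>' * N)
          ((2 * (N + 1) ^ b) ^ i)"
        proof (rule IH[OF _ q1], unfold_locales)
          have tot: "q * e / 4 \<le> wdeg A (lk L) {}"
            using total_lk_ge[OF _ L(1)] True by (simp add: q_def)
          show "0 < wdeg A (lk L) {}"
            using tot mult_pos_pos[OF q_pos e_pos] by linarith
          show "wdeg A (lk L) T \<le> K2 * q ^ (card T - 1) * wdeg A (lk L) {} / N"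
            if T: "T \<subseteq> A" "T \<noteq> {}" for T
          proof -
            have "card T \<noteq> 0" using T fin finite_subset[of T A] by simp
            then obtain t where t: "card T = Suc t" by (cases "card T") auto
            have "K * (q ^ card T * e / N) \<le> K' * (q ^ card T * e / N)"
              using \<open>K \<le> K'\<close> q_pos e_pos N_pos by (intro mult_right_mono) auto
            then have "wdeg A (lk L) T \<le> 2 * K' * q ^ card T * e / N"
              using wdeg_lk_le[OF L(1) T] by (simp add: \<tau>_def)
            also have "\<dots> = K2 * q ^ t * (q * e / 4) / N"
              by (simp add: t K2_def K'_def)
            also have "\<dots> \<le> K2 * q ^ t * wdeg A (lk L) {} / N"
              using tot K2 q_pos N_pos by (intro divide_right_mono mult_left_mono) auto
            finally show ?thesis by (simp add: t)
          qed
          show "f \<subseteq> A \<and> card f = i" if "lk L f \<noteq> 0" for f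
            using lk_unif[OF that] by simp
        qed (use fin lk_nonneg N_pos card_A q_def b_pos K2 in auto)
        then obtain \<C> where "finite \<C>" "real (card \<C>) \<le> (2 * (N + 1) ^ b) ^ i"
          "\<forall>C\<in>\<C>. C \<subseteq> A \<and> real (card C) \<le> real (card A) - \<delta>' * N"
          "\<forall>I. I \<subseteq> A \<and> windep (lk L) I \<longrightarrow> (\<exists>C\<in>\<C>. I \<subseteq> C)"
          unfolding has_containers_def by (elim exE conjE) (rule that)
        note \<C> = this(1,2) this(3,4)[rule_format]
        show ?thesis
        proof (rule has_containersI)
          \<comment> \<open>Adding \<open>light L\<close> costs at most a factor 2, since the bound
            from the induction hypothesis is at least 1.\<close>
          have "card (insert (light L) \<C>) \<le> Suc (card \<C>)"
            using \<C>(1) by (simp add: card_insert_if)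
          then show "real (card (insert (light L) \<C>)) \<le> 2 * (2 * (N + 1) ^ b) ^ i"
            using \<C>(2) one by linarith
          show "C \<subseteq> A \<and> real (card C) \<le> real (card A) - \<delta> * N" if "C \<in> insert (light L) \<C>" for C
            using that light \<C>(3)[of C] \<delta>N(1) by auto
        qed (use \<C>(1,4) in \<open>auto simp: P_def\<close>)
      qed
    qed
    have card\<L>: "real (card \<L>) \<le> (N + 1) ^ b"
    proof -
      have "real (card \<L>) \<le> real ((card A + 1) ^ b)"
        unfolding \<L>_def using card_lists_length_le_power[OF fin] of_nat_mono by blast
      also have "\<dots> \<le> (N + 1) ^ b"
        using card_A by (simp add: power_mono)
      finally show ?thesis .
    qed
    have cover: "\<exists>L\<in>\<L>. I \<subseteq> A \<and> P L I" if I: "I \<subseteq> A" "windep w I" for I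
    proof -
      obtain L where L: "set L \<subseteq> I" "heavy L" "length L = b \<or> length L < b \<and> I \<subseteq> light L"
        using heavy_list_exists[OF I(1)] by blast
      then have "L \<in> \<L>" "P L I"
        using I lk_windep[OF I(2) L(1)] by (auto simp: \<L>_def P_def)
      with I(1) show ?thesis by blast
    qed
    have "has_containers A (windep w) (\<lambda>C. real (card C) \<le> real (card A) - \<delta> * N)
        ((N + 1) ^ b * (2 * (2 * (N + 1) ^ b) ^ i))"
      using one by (intro has_containers_UN[OF fin\<L> P subset_refl card\<L> _ cover]) simp_all
    then show ?thesis by (simp add: mult_ac)
  qed
  note main = this
  show ?case
    by (rule exI[of _ \<delta>], rule conjI[OF \<delta>], rule exI[of _ q0], rule conjI[OF q0],
        intro allI impI, rule main)
qed

text \<open>A container violating \<open>Q\<close> is replaced by containers smaller by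
  \<open>d\<close>. With at most \<open>k * d\<close> elements at the start, nothing is left after
  \<open>k\<close> such rounds, and each round multiplies the count by at most
  \<open>M\<close>.\<close>

lemma iterate_containers:
  fixes d M :: real
  assumes "0 < d" "1 \<le> M" "finite A" "real (card A) \<le> real k * d"
    and step: "\<And>B. B \<subseteq> A \<Longrightarrow> \<not> Q B \<Longrightarrow> has_containers B P (\<lambda>C. real (card C) \<le> real (card B) - d) M"
  shows "has_containers A P Q (M ^ k)"
  using assms(3-5)
proof (induction k arbitrary: A)
  case (0 A)
  show ?case
  proof (cases "Q A")
    case False
    from "0.prems"(3)[OF subset_refl False] obtain \<C> where "finite \<C>" "real (card \<C>) \<le> M"
       "\<forall>C\<in>\<C>. C \<subseteq> A \<and> real (card C) \<le> real (card A) - d"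
       "\<forall>I. I \<subseteq> A \<and> P I \<longrightarrow> (\<exists>C\<in>\<C>. I \<subseteq> C)"
      unfolding has_containers_def by (elim exE conjE) (rule that)
    note \<C> = this(3,4)[rule_format]
    \<comment> \<open>Here \<open>A\<close> is empty, and no container can have at most
      \<open>- d\<close> elements, so there is no set to be covered.\<close>
    have "\<C> = {}"
      using \<C>(1) "0.prems"(2) \<open>0 < d\<close> by fastforce
    with \<C> show ?thesis by (intro has_containersI[of "{}"]) auto
  qed (intro has_containersI[of "{A}"], auto)
next
  case (Suc k A)
  show ?case
  proof (cases "Q A")
    case False
    from Suc.prems(3)[OF subset_refl False] obtain \<C> where "finite \<C>" "real (card \<C>) \<le> M"
       "\<forall>C\<in>\<C>. C \<subseteq> A \<and> real (card C) \<le> real (card A) - d"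
       "\<forall>I. I \<subseteq> A \<and> P I \<longrightarrow> (\<exists>C\<in>\<C>. I \<subseteq> C)"
      unfolding has_containers_def by (elim exE conjE) (rule that)
    note \<C> = this(1,2) this(3,4)[rule_format]
    have "has_containers C P Q (M ^ k)" if "C \<in> \<C>" for C
    proof (rule Suc.IH)
      have "real (card A) - d \<le> real k * d"
        using Suc.prems(2) by (simp add: algebra_simps)
      then show "real (card C) \<le> real k * d"
        using \<C>(3)[OF that] by linarith
      show "finite C" using \<C>(3)[OF that] Suc.prems(1) finite_subset by blast
      show "has_containers B P (\<lambda>C. real (card C) \<le> real (card B) - d) M"
        if "B \<subseteq> C" "\<not> Q B" for B
        using that \<C>(3)[OF \<open>C \<in> \<C>\<close>] by (intro Suc.prems(3)) auto
    qed
    then have "has_containers A P Q (M * M ^ k)"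
      using \<C> \<open>1 \<le> M\<close> by (intro has_containers_UN[of \<C> "\<lambda>C. C" "\<lambda>_. P"]) auto
    then show ?thesis by simp
  next
    case True
    have "1 \<le> M ^ Suc k" using \<open>1 \<le> M\<close> by (rule one_le_power)
    with True show ?thesis by (intro has_containersI[of "{A}"]) auto
  qed
qed

subsection \<open>Random subsets\<close>

text \<open>Union bound for the random subset \<open>G\<close> of \<open>V\<close> that contains
  each element independently with probability \<open>p\<close>: the summands are the probabilities
  of \<open>W i \<subseteq> G\<close> and of \<open>G \<subseteq> D j\<close>.\<close>

lemma random_subset_exists:
  fixes p :: real
  assumes "finite V" "0 \<le> p" "p \<le> 1" "finite I" "finite J"
    and "\<And>i. i \<in> I \<Longrightarrow> W i \<subseteq> V"
    and "(\<Sum>i\<in>I. p ^ card (W i)) + (\<Sum>j\<in>J. (1 - p) ^ card (V - D j)) < 1"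
  shows "\<exists>G\<subseteq>V. (\<forall>i\<in>I. \<not> W i \<subseteq> G) \<and> (\<forall>j\<in>J. \<not> G \<subseteq> D j)"
proof (rule ccontr)
  assume "\<not> ?thesis"
  then have bad: "(\<exists>i\<in>I. W i \<subseteq> G) \<or> (\<exists>j\<in>J. G \<subseteq> D j)" if "G \<in> Pow V" for G
    using that by blast
  \<comment> \<open>The probability of the outcome \<open>G\<close>; finite sums over
    \<open>Pow V\<close> take the place of a probability space.\<close>
  define m where "m G = (\<Prod>x\<in>G. p) * (\<Prod>x\<in>V - G. 1 - p)" for G :: "'a set"
  have m0: "0 \<le> m G" for G using assms(2,3) by (simp add: m_def)
  have tot: "(\<Sum>G\<in>Pow V. m G) = 1"
    using prod_add[OF assms(1), of "\<lambda>_. p" "\<lambda>_. 1 - p"] by (simp add: m_def)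
  \<comment> \<open>Replacing the factor \<open>1 - p\<close> by 0 on \<open>U\<close> encodes
    \<open>U \<subseteq> G\<close>, and \<open>prod_add\<close> then factorises the sum.\<close>
  have up: "(\<Sum>G\<in>Pow V. if U \<subseteq> G then m G else 0) = p ^ card U" if "U \<subseteq> V" for U
  proof -
    have "(\<Sum>G\<in>Pow V. if U \<subseteq> G then m G else 0) =
       (\<Sum>G\<in>Pow V. (\<Prod>x\<in>G. p) * (\<Prod>x\<in>V - G. if x \<in> U then 0 else 1 - p))"
    proof (intro sum.cong refl)
      fix G assume "G \<in> Pow V"
      show "(if U \<subseteq> G then m G else 0) = (\<Prod>x\<in>G. p) * (\<Prod>x\<in>V - G. if x \<in> U then 0 else 1 - p)"
      proof (cases "U \<subseteq> G")
        case True
        then have "(\<Prod>x\<in>V - G. if x \<in> U then 0 else 1 - p) = (\<Prod>x\<in>V - G. 1 - p)"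
          by (intro prod.cong) auto
        with True show ?thesis by (simp add: m_def)
      next
        case False
        then obtain x where "x \<in> U" "x \<notin> G" by blast
        then have "(\<Prod>x\<in>V - G. if x \<in> U then 0 else 1 - p) = 0"
          using that assms(1) by (intro prod_zero) auto
        with False show ?thesis by simp
      qed
    qed
    also have "\<dots> = (\<Prod>x\<in>V. p + (if x \<in> U then 0 else 1 - p))"
      by (rule prod_add[OF assms(1), symmetric])
    also have "\<dots> = (\<Prod>x\<in>V. if x \<in> U then p else 1)"
      by (intro prod.cong) auto
    also have "\<dots> = p ^ card U"
      using that assms(1) by (simp add: prod.If_cases Int_absorb1)
    finally show ?thesis .
  qed
  \<comment> \<open>Dually, the factor \<open>p\<close> is replaced by 0 outside
    \<open>U\<close>.\<close>
  have down: "(\<Sum>G\<in>Pow V. if G \<subseteq> U then m G else 0) = (1 - p) ^ card (V - U)" for U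
  proof -
    have "(\<Sum>G\<in>Pow V. if G \<subseteq> U then m G else 0) =
       (\<Sum>G\<in>Pow V. (\<Prod>x\<in>G. if x \<in> U then p else 0) * (\<Prod>x\<in>V - G. 1 - p))"
    proof (intro sum.cong refl)
      fix G assume G: "G \<in> Pow V"
      show "(if G \<subseteq> U then m G else 0) = (\<Prod>x\<in>G. if x \<in> U then p else 0) * (\<Prod>x\<in>V - G. 1 - p)"
      proof (cases "G \<subseteq> U")
        case True
        then have "(\<Prod>x\<in>G. if x \<in> U then p else 0) = (\<Prod>x\<in>G. p)"
          by (intro prod.cong) auto
        with True show ?thesis by (simp add: m_def)
      next
        case False
        then have "(\<Prod>x\<in>G. if x \<in> U then p else 0) = 0"
          using G assms(1) finite_subset by (intro prod_zero) auto
        with False show ?thesis by simp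
      qed
    qed
    also have "\<dots> = (\<Prod>x\<in>V. (if x \<in> U then p else 0) + (1 - p))"
      by (rule prod_add[OF assms(1), symmetric])
    also have "\<dots> = (\<Prod>x\<in>V. if x \<in> U then 1 else 1 - p)"
      by (intro prod.cong) auto
    also have "\<dots> = (1 - p) ^ card (V - U)"
      using assms(1) by (simp add: prod.If_cases Diff_eq)
    finally show ?thesis .
  qed
  have "1 = (\<Sum>G\<in>Pow V. m G)" using tot by simp
  also have "\<dots> \<le> (\<Sum>G\<in>Pow V. (\<Sum>i\<in>I. if W i \<subseteq> G then m G else 0) + (\<Sum>j\<in>J. if G \<subseteq> D j then m G else 0))"
  proof (rule sum_mono)
    fix G assume "G \<in> Pow V"
    have nn: "0 \<le> (\<Sum>i\<in>I. if W i \<subseteq> G then m G else 0)" "0 \<le> (\<Sum>j\<in>J. if G \<subseteq> D j then m G else 0)"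
      by (intro sum_nonneg; simp add: m0)+
    from bad[OF \<open>G \<in> Pow V\<close>]
    show "m G \<le> (\<Sum>i\<in>I. if W i \<subseteq> G then m G else 0) + (\<Sum>j\<in>J. if G \<subseteq> D j then m G else 0)"
    proof (elim disjE bexE)
      fix i assume "i \<in> I" "W i \<subseteq> G"
      then have "m G \<le> (\<Sum>i\<in>I. if W i \<subseteq> G then m G else 0)"
        using member_le_sum[of i I "\<lambda>i. if W i \<subseteq> G then m G else 0"] assms(4) m0 by simp
      with nn show ?thesis by linarith
    next
      fix j assume "j \<in> J" "G \<subseteq> D j"
      then have "m G \<le> (\<Sum>j\<in>J. if G \<subseteq> D j then m G else 0)"
        using member_le_sum[of j J "\<lambda>j. if G \<subseteq> D j then m G else 0"] assms(5) m0 by simp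
      with nn show ?thesis by linarith
    qed
  qed
  also have "\<dots> = (\<Sum>i\<in>I. \<Sum>G\<in>Pow V. if W i \<subseteq> G then m G else 0) +
      (\<Sum>j\<in>J. \<Sum>G\<in>Pow V. if G \<subseteq> D j then m G else 0)"
    unfolding sum.distrib by (intro arg_cong2[of _ _ _ _ "(+)"] sum.swap)
  also have "\<dots> = (\<Sum>i\<in>I. p ^ card (W i)) + (\<Sum>j\<in>J. (1 - p) ^ card (V - D j))"
    using up assms(6) down by simp
  finally show False using assms(7) by linarith
qed

subsection \<open>Copies of an ordered graph\<close>

text \<open>The rank in \<open>S\<close> followed by the increasing enumeration of
  \<open>T\<close>.\<close>

lemma ex_strict_mono_bij:
  fixes S :: "'a::linorder set" and T :: "nat set"
  assumes "finite S" "finite T" "card S = card T"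
  shows "\<exists>f. bij_betw f S T \<and> strict_mono_on S f"
proof -
  define r where "r v = card {u \<in> S. u < v}" for v
  have mono: "strict_mono_on S r"
  proof (rule strict_mono_onI)
    fix u v assume "u \<in> S" "v \<in> S" "u < v"
    then have "{w \<in> S. w < u} \<subset> {w \<in> S. w < v}" by force
    then show "r u < r v" unfolding r_def using assms(1) by (intro psubset_card_mono) auto
  qed
  have inj: "inj_on r S" using mono by (rule strict_mono_on_imp_inj_on)
  have "r v < card S" if "v \<in> S" for v
    unfolding r_def using assms(1) that by (intro psubset_card_mono) auto
  then have sub: "r ` S \<subseteq> {..<card S}" by auto
  have im: "r ` S = {..<card S}"
    using sub inj by (intro card_subset_eq) (auto simp: card_image)
  obtain h where h: "bij_betw h {..<card T} T" "strict_mono_on {..<card T} h"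
    using ex_bij_betw_strict_mono_card[OF assms(2)] by blast
  have "bij_betw (h \<circ> r) S T"
    using inj im h(1) assms(3) by (intro bij_betw_trans[of r S "{..<card T}"]) (auto simp: bij_betw_def)
  moreover have "strict_mono_on S (h \<circ> r)"
  proof (rule strict_mono_onI)
    fix u v assume "u \<in> S" "v \<in> S" "u < v"
    moreover from this have "r u < r v" using mono by (auto simp: strict_mono_on_def)
    ultimately show "(h \<circ> r) u < (h \<circ> r) v"
      using h(2) sub assms(3) by (auto simp: strict_mono_on_def image_subset_iff)
  qed
  ultimately show ?thesis by blast
qed

lemma card_supersets_le:
  assumes "finite V" "X \<subseteq> V"
  shows "card {R. R \<subseteq> V \<and> card R = r \<and> X \<subseteq> R} \<le> card V ^ (r - card X)"
proof -
  have fX: "finite X" using assms finite_subset by auto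
  have "card {R. R \<subseteq> V \<and> card R = r \<and> X \<subseteq> R} \<le> card {R. R \<subseteq> V \<and> card R = r - card X}"
  proof (rule card_inj_on_le[of "\<lambda>R. R - X"])
    show "inj_on (\<lambda>R. R - X) {R. R \<subseteq> V \<and> card R = r \<and> X \<subseteq> R}"
      by (intro inj_onI) blast
    show "(\<lambda>R. R - X) ` {R. R \<subseteq> V \<and> card R = r \<and> X \<subseteq> R} \<subseteq> {R. R \<subseteq> V \<and> card R = r - card X}"
      using fX by (auto simp: card_Diff_subset)
  qed (use assms in auto)
  also have "\<dots> = card V choose (r - card X)"
    by (rule n_subsets[OF assms(1)])
  also have "\<dots> \<le> card V ^ (r - card X)"
    by (cases "r - card X \<le> card V") (simp_all add: binomial_le_pow binomial_eq_0)
  finally show ?thesis .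
qed

lemma finite_edges_ordered_graph:
  assumes "ordered_graph G"
  shows "finite (edges G)"
proof (rule finite_subset)
  show "edges G \<subseteq> Pow (verts G)" using assms by (auto simp: ordered_graph_def)
  show "finite (Pow (verts G))" using assms by (simp add: ordered_graph_def)
qed

text \<open>Two edges make the 2-density positive, so that the exponent \<open>- 1 / m2\<close> is
  meaningful. Patterns without edges are handled by \<open>edgeless_ramsey_graph\<close>.\<close>

locale pattern =
  fixes H :: "'a::linorder ograph"
  assumes ograph: "ordered_graph H" and two_edges: "2 \<le> card (edges H)"
begin

definition "nv = card (verts H)"
definition "m2 = two_density H"

lemma finite_verts: "finite (verts H)"
  using ograph by (simp add: ordered_graph_def)

lemma edgeD: "e \<in> edges H \<Longrightarrow> e \<subseteq> verts H \<and> card e = 2"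
  using ograph by (simp add: ordered_graph_def)

lemma finite_edges: "finite (edges H)"
  using ograph by (rule finite_edges_ordered_graph)

lemma m2_ge:
  assumes "subgraph G H" "3 \<le> card (verts G)" "1 \<le> card (edges G)"
  shows "(real (card (edges G)) - 1) / (real (card (verts G)) - 2) \<le> m2"
proof -
  have "{(real (card (edges G')) - 1) / (real (card (verts G')) - 2) | G'.
        subgraph G' H \<and> card (verts G') \<ge> 3 \<and> card (edges G') \<ge> 1} \<subseteq>
      (\<lambda>(V, E). (real (card E) - 1) / (real (card V) - 2)) ` (Pow (verts H) \<times> Pow (edges H))"
    by (force simp: subgraph_def)
  then have "finite {(real (card (edges G')) - 1) / (real (card (verts G')) - 2) | G'.
        subgraph G' H \<and> card (verts G') \<ge> 3 \<and> card (edges G') \<ge> 1}"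
    using finite_verts finite_edges finite_subset by blast
  then show ?thesis
    unfolding m2_def two_density_def using assms by (intro Max_ge) auto
qed

lemma card_Union_two_edges:
  assumes "a \<in> edges H" "b \<in> edges H" "a \<noteq> b"
  shows "3 \<le> card (a \<union> b)"
proof (rule ccontr)
  assume "\<not> 3 \<le> card (a \<union> b)"
  then have le: "card (a \<union> b) \<le> 2" by simp
  have "finite (a \<union> b)" using edgeD[OF assms(1)] edgeD[OF assms(2)] finite_verts finite_subset by blast
  then have "a = a \<union> b" "b = a \<union> b"
    using edgeD[OF assms(1)] edgeD[OF assms(2)] le by (intro card_seteq; simp)+
  with assms(3) show False by simp
qed

text \<open>The product form also covers a single edge, for which both sides vanish and the quotient
  would be \<open>0 / 0\<close>.\<close>

lemma edge_set_density:
  assumes "J \<subseteq> edges H" "J \<noteq> {}"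
  shows "2 \<le> card (\<Union>J)" "real (card J) - 1 \<le> m2 * (real (card (\<Union>J)) - 2)"
proof -
  have finJ: "finite J" using assms(1) finite_edges finite_subset by auto
  have sub: "\<Union>J \<subseteq> verts H" using assms(1) edgeD by blast
  have finU: "finite (\<Union>J)" using sub finite_verts finite_subset by auto
  obtain a where a: "a \<in> J" using assms(2) by auto
  have "card a \<le> card (\<Union>J)" using a finU by (intro card_mono) auto
  then show 2: "2 \<le> card (\<Union>J)" using a assms(1) edgeD by auto
  show "real (card J) - 1 \<le> m2 * (real (card (\<Union>J)) - 2)"
  proof (cases "J = {a}")
    case True
    then have "card (\<Union>J) = 2" using a assms(1) edgeD by auto
    with True show ?thesis by simp
  next
    case False
    then obtain b where b: "b \<in> J" "a \<noteq> b" using a by blast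
    have "3 \<le> card (a \<union> b)" using a b assms(1) by (intro card_Union_two_edges) auto
    also have "\<dots> \<le> card (\<Union>J)" using a b finU by (intro card_mono) auto
    finally have 3: "3 \<le> card (\<Union>J)" .
    have "1 \<le> card J" using a finJ by (simp add: Suc_leI card_gt_0_iff assms(2))
    moreover have "subgraph (OGraph (\<Union>J) J) H"
      using ograph sub assms(1) finU edgeD by (auto simp: subgraph_def ordered_graph_def)
    ultimately have "(real (card J) - 1) / (real (card (\<Union>J)) - 2) \<le> m2"
      using m2_ge[of "OGraph (\<Union>J) J"] 3 by simp
    then show ?thesis using 3 by (simp add: pos_divide_le_eq)
  qed
qed

text \<open>Two distinct edges span three or four vertices, and the quotient for them is at least
  \<open>1 / 2\<close>. Later this makes the exponent \<open>2 - 1 / m2\<close> nonnegative.\<close>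

lemma m2_ge_half: "1 / 2 \<le> m2" and nv_ge: "3 \<le> nv"
proof -
  obtain a b where ab: "a \<in> edges H" "b \<in> edges H" "a \<noteq> b"
    using two_edges card_le_Suc0_iff_eq[OF finite_edges] by force
  have "card (a \<union> b) \<le> card a + card b" by (rule card_Un_le)
  then have 4: "card (a \<union> b) \<le> 4" using ab edgeD by simp
  have 3: "3 \<le> card (a \<union> b)" using ab by (rule card_Union_two_edges)
  have m: "1 \<le> m2 * (real (card (a \<union> b)) - 2)"
    using edge_set_density(2)[of "{a, b}"] ab by simp
  have "0 < m2"
  proof (rule ccontr)
    assume "\<not> 0 < m2"
    then have "m2 * (real (card (a \<union> b)) - 2) \<le> 0"
      using 3 by (intro mult_nonpos_nonneg) auto
    with m show False by linarith
  qed
  then have "m2 * (real (card (a \<union> b)) - 2) \<le> m2 * 2" using 4 by (intro mult_left_mono) auto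
  with m show "1 / 2 \<le> m2" by simp
  have "card (a \<union> b) \<le> nv"
    unfolding nv_def using ab edgeD finite_verts by (intro card_mono) auto
  with 3 show "3 \<le> nv" by simp
qed

text \<open>Every \<open>nv\<close>-element set of numbers is the vertex set of exactly one copy of \<open>H\<close> in the complete
  graph, so copies are counted by their vertex sets.\<close>

definition "emb S = (SOME f :: 'a \<Rightarrow> nat. bij_betw f (verts H) S \<and> strict_mono_on (verts H) f)"
definition "copy S = (\<lambda>e. emb S ` e) ` edges H"
definition "pairs n = {e :: nat set. e \<subseteq> {..<n} \<and> card e = 2}"
definition "vsets n = {S :: nat set. S \<subseteq> {..<n} \<and> card S = nv}"
definition "copies n T A = {S \<in> vsets n. T \<subseteq> copy S \<and> copy S \<subseteq> A}"

lemma emb: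
  assumes "finite S" "card S = nv"
  shows "bij_betw (emb S) (verts H) S" "strict_mono_on (verts H) (emb S)"
  using someI_ex[OF ex_strict_mono_bij[of "verts H" S]] assms finite_verts
  by (simp_all add: emb_def nv_def)

lemma finite_vsets: "finite (vsets n)"
  by (auto simp: vsets_def intro: finite_subset[of _ "Pow {..<n}"])

lemma finite_copies: "finite (copies n T A)"
  using finite_vsets by (simp add: copies_def)

lemma finite_pairs: "finite (pairs n)"
  by (auto simp: pairs_def intro: finite_subset[of _ "Pow {..<n}"])

lemma card_pairs_le: "real (card (pairs n)) \<le> (real n)\<^sup>2"
proof -
  have "card (pairs n) = n choose 2"
    unfolding pairs_def using n_subsets[of "{..<n}" 2] by simp
  also have "\<dots> \<le> n ^ 2"
    by (cases "2 \<le> n") (simp_all add: binomial_le_pow binomial_eq_0)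
  finally show ?thesis by (metis of_nat_le_iff of_nat_power)
qed

lemma vsetsD: "S \<in> vsets n \<Longrightarrow> finite S \<and> card S = nv \<and> S \<subseteq> {..<n}"
  using finite_subset[of S "{..<n}"] by (simp add: vsets_def)

lemma copy_edgeD:
  assumes "finite S" "card S = nv" "x \<in> copy S"
  shows "x \<subseteq> S \<and> card x = 2"
proof -
  obtain e where e: "e \<in> edges H" "x = emb S ` e" using assms(3) by (auto simp: copy_def)
  have "inj_on (emb S) (verts H)" "emb S ` verts H = S"
    using emb(1)[OF assms(1,2)] by (auto simp: bij_betw_def)
  with e edgeD[OF e(1)] show ?thesis
    using inj_on_subset by (fastforce simp: card_image)
qed

lemma inj_on_image_edges:
  assumes "finite S" "card S = nv"
  shows "inj_on (\<lambda>e. emb S ` e) (edges H)"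
proof (rule inj_onI)
  fix a b assume "a \<in> edges H" "b \<in> edges H" "emb S ` a = emb S ` b"
  then show "a = b"
    using edgeD emb(1)[OF assms] inj_on_image_eq_iff[of "emb S" "verts H"]
    by (auto simp: bij_betw_def)
qed

lemma card_copy:
  assumes "finite S" "card S = nv"
  shows "card (copy S) = card (edges H)"
  unfolding copy_def using inj_on_image_edges[OF assms] by (rule card_image)

lemma copy_subset_pairs:
  assumes "S \<in> vsets n"
  shows "copy S \<subseteq> pairs n"
proof
  fix x assume "x \<in> copy S"
  with copy_edgeD[of S x] vsetsD[OF assms] show "x \<in> pairs n" by (auto simp: pairs_def)
qed

lemma copy_is_copy:
  assumes "S \<in> vsets n" "copy S \<subseteq> G" "G \<subseteq> pairs n"
  shows "is_copy H (OGraph {..<n} G) (OGraph S (copy S))"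
proof -
  have S: "finite S" "card S = nv" "S \<subseteq> {..<n}" using vsetsD[OF assms(1)] by auto
  have "ordered_graph (OGraph {..<n} G)"
    using assms(3) by (auto simp: ordered_graph_def pairs_def)
  moreover have "ordered_graph (OGraph S (copy S))"
    using copy_edgeD[OF S(1,2)] S(1) by (auto simp: ordered_graph_def)
  ultimately have "subgraph (OGraph S (copy S)) (OGraph {..<n} G)"
    using S(3) assms(2) by (simp add: subgraph_def)
  moreover have "ograph_iso H (OGraph S (copy S))"
    unfolding ograph_iso_def using emb[OF S(1,2)] by (auto simp: copy_def)
  ultimately show ?thesis by (simp add: is_copy_def)
qed

section \<open>Codegrees of copies and supersaturation\<close>

text \<open>This is where the 2-density enters. A copy containing \<open>T\<close> has a vertex set
  containing the \<open>u\<close> vertices of \<open>\<Union>T\<close>, which leaves at most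
  \<open>n ^ (nv - u)\<close> choices. As \<open>card T - 1\<close> is at most
  \<open>m2 * (u - 2)\<close>, the lost factor \<open>n ^ (u - 2)\<close> pays for
  \<open>card T - 1\<close> factors \<open>q\<close>.\<close>

lemma card_copies_le:
  fixes q :: real
  assumes "T \<noteq> {}" "1 \<le> n" "real n powr (- 1 / m2) \<le> q"
  shows "real (card (copies n T A)) \<le> q ^ (card T - 1) * real n ^ (nv - 2)"
proof (cases "copies n T A = {}")
  case True
  have "0 \<le> q" using assms(3) powr_ge_zero order_trans by blast
  with True show ?thesis by simp
next
  case False
  then obtain S where S: "S \<in> vsets n" "T \<subseteq> copy S" by (auto simp: copies_def)
  then have S': "finite S" "card S = nv" "S \<subseteq> {..<n}" using vsetsD by auto
  define f where "f = emb S"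
  have inj: "inj_on f (verts H)" using emb(1)[OF S'(1,2)] by (auto simp: f_def bij_betw_def)
  \<comment> \<open>One copy containing \<open>T\<close> pulls it back to a set \<open>J\<close> of
    edges of \<open>H\<close>, to which \<open>edge_set_density\<close> applies.\<close>
  obtain J where J: "J \<subseteq> edges H" "T = (\<lambda>e. f ` e) ` J"
    using S(2) by (auto simp: copy_def f_def subset_image_iff)
  have Jne: "J \<noteq> {}" using J assms(1) by auto
  have cJ: "card T = card J"
    unfolding J(2) using inj_on_subset[OF inj_on_image_edges[OF S'(1,2)] J(1)] by (simp add: card_image f_def)
  have "\<Union>T = f ` \<Union>J" using J(2) by auto
  moreover have "\<Union>J \<subseteq> verts H" using J(1) edgeD by blast
  ultimately have cU: "card (\<Union>T) = card (\<Union>J)"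
    using card_image[OF inj_on_subset[OF inj]] by simp
  define u where "u = card (\<Union>T)"
  have TS: "\<Union>T \<subseteq> S" using S(2) copy_edgeD[OF S'(1,2)] by blast
  then have "u \<le> nv" unfolding u_def using card_mono[OF S'(1)] S'(2) by simp
  have u2: "2 \<le> u" and dens: "real (card T) - 1 \<le> m2 * (real u - 2)"
    using edge_set_density[OF J(1) Jne] cJ cU by (auto simp: u_def)
  have "card (copies n T A) \<le> card {R. R \<subseteq> {..<n} \<and> card R = nv \<and> \<Union>T \<subseteq> R}"
  proof (rule card_mono)
    show "copies n T A \<subseteq> {R. R \<subseteq> {..<n} \<and> card R = nv \<and> \<Union>T \<subseteq> R}"
    proof
      fix R assume R: "R \<in> copies n T A"
      then have "R \<in> vsets n" "T \<subseteq> copy R" by (auto simp: copies_def)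
      moreover from this have "\<Union>T \<subseteq> R" using copy_edgeD vsetsD by blast
      ultimately show "R \<in> {R. R \<subseteq> {..<n} \<and> card R = nv \<and> \<Union>T \<subseteq> R}" using vsetsD by auto
    qed
  qed (auto intro: finite_subset[of _ "Pow {..<n}"])
  also have "\<dots> \<le> n ^ (nv - u)"
    using card_supersets_le[of "{..<n}" "\<Union>T" nv] TS S'(3) by (auto simp: u_def)
  finally have "real (card (copies n T A)) \<le> real n ^ (nv - u)"
    by (metis of_nat_le_iff of_nat_power)
  also have "\<dots> = real n powr (- (real u - 2)) * real n ^ (nv - 2)"
  proof -
    have "real n ^ (nv - 2) = real n ^ (nv - u) * real n ^ (u - 2)"
      using u2 \<open>u \<le> nv\<close> by (simp flip: power_add)
    moreover have "real n powr (- (real u - 2)) * real n ^ (u - 2) = 1"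
      using assms(2) u2 by (simp add: powr_realpow[symmetric] powr_add[symmetric] of_nat_diff)
    ultimately show ?thesis by (simp add: mult_ac)
  qed
  also have "\<dots> \<le> q ^ (card T - 1) * real n ^ (nv - 2)"
  proof (rule mult_right_mono)
    have m2: "0 < m2" using m2_ge_half by simp
    have cT: "1 \<le> card T"
      using cJ Jne J(1) finite_edges finite_subset by (metis card_gt_0_iff One_nat_def Suc_leI)
    have "real n powr (- (real u - 2)) \<le> real n powr (real (card T - 1) * (- 1 / m2))"
      using assms(2) dens m2 cT by (intro powr_mono) (auto simp: field_simps of_nat_diff)
    also have "\<dots> = (real n powr (- 1 / m2)) ^ (card T - 1)"
    proof -
      have "(real n powr (- 1 / m2)) ^ (card T - 1) = (real n powr (- 1 / m2)) powr real (card T - 1)"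
        using assms(2) by (intro powr_realpow[symmetric]) simp
      also have "\<dots> = real n powr ((- 1 / m2) * real (card T - 1))"
        by (rule powr_powr)
      finally show ?thesis by (simp only: mult.commute)
    qed
    also have "\<dots> \<le> q ^ (card T - 1)"
      using assms(3) by (intro power_mono) auto
    finally show "real n powr (- (real u - 2)) \<le> q ^ (card T - 1)" .
  qed simp
  finally show ?thesis .
qed

text \<open>By Ramsey's theorem every set of \<open>r\<close> vertices contains a copy inside
  \<open>C1\<close>, a copy inside \<open>C2\<close>, or a pair missed by both. Few copies account
  for few of these sets, so missed pairs account for a positive proportion, and each pair lies in at
  most \<open>n ^ (r - 2)\<close> of them.\<close>

lemma supersaturation:
  "\<exists>\<epsilon>>0. \<epsilon> \<le> 1 \<and> (\<exists>\<eta>>0. \<exists>n0\<ge>1. \<forall>n\<ge>n0. \<forall>C1 C2. 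
     real (card (copies n {} C1)) < \<epsilon> * real n ^ nv \<longrightarrow> real (card (copies n {} C2)) < \<epsilon> * real n ^ nv \<longrightarrow>
     \<eta> * (real n)\<^sup>2 \<le> real (card (pairs n - (C1 \<union> C2))))"
proof -
  obtain r0 where r0: "\<forall>(V :: nat set) E. finite V \<and> r0 \<le> card V \<longrightarrow>
      (\<exists>R\<subseteq>V. card R = nv \<and> clique R E \<or> card R = nv \<and> indep R E)"
    using ramsey2[of nv nv, where 'a = nat] by (elim exE conjE) (rule that)
  \<comment> \<open>The maximum keeps the truncated subtraction \<open>r - nv\<close> exact.\<close>
  define r where "r = max r0 nv"
  have rnv: "nv \<le> r" and r3: "3 \<le> r" using nv_ge by (auto simp: r_def)
  \<comment> \<open>There are at least \<open>(n / r) ^ r = 4 * \<epsilon> * n ^ r\<close> sets of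
    size \<open>r\<close>. Copies in \<open>C1\<close> and in \<open>C2\<close> use up
    \<open>\<epsilon> * n ^ r\<close> each, and \<open>\<eta> = 2 * \<epsilon>\<close> is left for
    the missed pairs.\<close>
  define \<epsilon> where "\<epsilon> = 1 / (4 * real r ^ r)"
  define \<eta> where "\<eta> = 1 / (2 * real r ^ r)"
  have rr: "1 \<le> real r ^ r" using r3 by (intro one_le_power) auto
  have "\<eta> * (real n)\<^sup>2 \<le> real (card (pairs n - (C1 \<union> C2)))"
    if n: "r \<le> n" and C1: "real (card (copies n {} C1)) < \<epsilon> * real n ^ nv"
      and C2: "real (card (copies n {} C2)) < \<epsilon> * real n ^ nv" for n C1 C2
  proof -
    define D where "D = pairs n - (C1 \<union> C2)"
    define \<R> where "\<R> X = {R. R \<subseteq> {..<n} \<and> card R = r \<and> X \<subseteq> R}" for X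
    have \<R>_le: "real (card (\<R> X)) \<le> real n ^ (r - card X)" if "X \<subseteq> {..<n}" for X
    proof -
      have "card (\<R> X) \<le> n ^ (r - card X)"
        using card_supersets_le[OF _ that, of r] by (simp add: \<R>_def)
      then show ?thesis by (simp flip: of_nat_power)
    qed
    have fin\<R>: "finite (\<R> X)" for X
      by (auto simp: \<R>_def intro: finite_subset[of _ "Pow {..<n}"])
    have "\<R> {} \<subseteq> (\<Union>e\<in>D. \<R> e) \<union> (\<Union>S\<in>copies n {} C1. \<R> S) \<union> (\<Union>S\<in>copies n {} C2. \<R> S)"
    proof
      fix R assume "R \<in> \<R> {}"
      then have R: "R \<subseteq> {..<n}" "card R = r" by (auto simp: \<R>_def)
      show "R \<in> (\<Union>e\<in>D. \<R> e) \<union> (\<Union>S\<in>copies n {} C1. \<R> S) \<union> (\<Union>S\<in>copies n {} C2. \<R> S)"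
      proof (cases "\<exists>e\<in>D. e \<subseteq> R")
        case False
        have finR: "finite R" using R(1) finite_subset by auto
        \<comment> \<open>Ramsey's theorem is applied to \<open>C1\<close> alone: since
          \<open>R\<close> contains no missed pair, an independent set of \<open>C1\<close> inside
          \<open>R\<close> has all its pairs in \<open>C2\<close>.\<close>
        obtain S where S: "S \<subseteq> R" "card S = nv" "clique S C1 \<or> indep S C1"
          using r0[rule_format, of R C1] finR R(2) by (auto simp: r_def)
        have finS: "finite S" using S(1) finR finite_subset by auto
        have Sv: "S \<in> vsets n" using S R by (auto simp: vsets_def)
        have edge: "\<exists>v w. x = {v, w} \<and> v \<in> S \<and> w \<in> S \<and> v \<noteq> w" if "x \<in> copy S" for x
          using copy_edgeD[OF finS S(2) that] by (auto simp: card_2_iff)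
        from S(3) have "copy S \<subseteq> C1 \<or> copy S \<subseteq> C2"
        proof
          assume "clique S C1"
          then have "copy S \<subseteq> C1" using edge unfolding clique_def by blast
          then show ?thesis ..
        next
          assume ind: "indep S C1"
          have "x \<in> C2" if x: "x \<in> copy S" for x
          proof -
            have "x \<notin> C1" using edge[OF x] ind by (auto simp: indep_def)
            moreover have "x \<in> pairs n" using copy_subset_pairs[OF Sv] x by blast
            moreover have "x \<subseteq> R" using copy_edgeD[OF finS S(2) x] S(1) by blast
            ultimately show ?thesis using False by (auto simp: D_def)
          qed
          then show ?thesis by blast
        qed
        then have "S \<in> copies n {} C1 \<or> S \<in> copies n {} C2" using Sv by (auto simp: copies_def)
        moreover have "R \<in> \<R> S" using R S(1) by (auto simp: \<R>_def)
        ultimately show ?thesis by blast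
      qed (use R in \<open>auto simp: \<R>_def\<close>)
    qed
    then have "card (\<R> {}) \<le> card ((\<Union>e\<in>D. \<R> e) \<union> (\<Union>S\<in>copies n {} C1. \<R> S) \<union> (\<Union>S\<in>copies n {} C2. \<R> S))"
      using finite_copies finite_pairs fin\<R> by (intro card_mono) (auto simp: D_def)
    also have "\<dots> \<le> card (\<Union>e\<in>D. \<R> e) + card (\<Union>S\<in>copies n {} C1. \<R> S) + card (\<Union>S\<in>copies n {} C2. \<R> S)"
      by (rule order_trans[OF card_Un_le add_right_mono[OF card_Un_le]])
    finally have main: "real (card (\<R> {})) \<le> real (card (\<Union>e\<in>D. \<R> e)) +
        real (card (\<Union>S\<in>copies n {} C1. \<R> S)) + real (card (\<Union>S\<in>copies n {} C2. \<R> S))"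
      by linarith
    have UN: "real (card (\<Union>X\<in>\<X>. \<R> X)) \<le> real (card \<X>) * real n ^ (r - k)"
      if "finite \<X>" "\<And>X. X \<in> \<X> \<Longrightarrow> X \<subseteq> {..<n} \<and> card X = k" for \<X> k
    proof -
      have "real (card (\<Union>X\<in>\<X>. \<R> X)) \<le> (\<Sum>X\<in>\<X>. real (card (\<R> X)))"
        using card_UN_le[OF that(1), of \<R>] by (simp flip: of_nat_sum)
      also have "\<dots> \<le> (\<Sum>X\<in>\<X>. real n ^ (r - k))"
        using that(2) \<R>_le by (intro sum_mono) metis
      finally show ?thesis by simp
    qed
    have c: "real (card (\<Union>S\<in>copies n {} C. \<R> S)) \<le> \<epsilon> * real n ^ r"
      if "real (card (copies n {} C)) < \<epsilon> * real n ^ nv" for C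
    proof -
      have "real (card (\<Union>S\<in>copies n {} C. \<R> S)) \<le> real (card (copies n {} C)) * real n ^ (r - nv)"
        using vsetsD by (intro UN finite_copies) (auto simp: copies_def)
      also have "\<dots> \<le> \<epsilon> * real n ^ nv * real n ^ (r - nv)"
        using that by (intro mult_right_mono) auto
      also have "\<dots> = \<epsilon> * real n ^ r"
        using rnv by (simp add: mult.assoc flip: power_add)
      finally show ?thesis .
    qed
    have d: "real (card (\<Union>e\<in>D. \<R> e)) \<le> real (card D) * real n ^ (r - 2)"
      using finite_pairs by (intro UN) (auto simp: D_def pairs_def)
    have "card (\<R> {}) = n choose r"
      unfolding \<R>_def using n_subsets[of "{..<n}" r] by simp
    then have "(real n / real r) ^ r \<le> real (card (\<R> {}))"
      using binomial_ge_n_over_k_pow_k[OF n, where 'a = real] by simp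
    with main d c[OF C1] c[OF C2]
    have "(real n / real r) ^ r \<le> real (card D) * real n ^ (r - 2) + 2 * (\<epsilon> * real n ^ r)"
      by linarith
    moreover have "(real n / real r) ^ r = 4 * (\<epsilon> * real n ^ r)"
      by (simp add: \<epsilon>_def power_divide)
    moreover have "2 * (\<epsilon> * real n ^ r) = \<eta> * real n ^ r" by (simp add: \<epsilon>_def \<eta>_def)
    ultimately have "\<eta> * real n ^ r \<le> real (card D) * real n ^ (r - 2)" by linarith
    moreover have "real n ^ r = (real n)\<^sup>2 * real n ^ (r - 2)"
    proof -
      have "2 + (r - 2) = r" using r3 by simp
      then show ?thesis using power_add[of "real n" 2 "r - 2"] by (simp only:)
    qed
    ultimately have "\<eta> * (real n)\<^sup>2 * real n ^ (r - 2) \<le> real (card D) * real n ^ (r - 2)"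
      by (simp add: mult.assoc)
    then have "\<eta> * (real n)\<^sup>2 \<le> real (card D)"
      using n r3 by (simp add: mult_le_cancel_right)
    then show ?thesis by (simp add: D_def)
  qed
  note main = this
  have "0 < \<epsilon>" "0 < \<eta>" using r3 by (auto simp: \<epsilon>_def \<eta>_def)
  moreover have "\<epsilon> \<le> 1"
  proof -
    have "1 \<le> 4 * real r ^ r" using rr by linarith
    then show ?thesis unfolding \<epsilon>_def by (subst divide_le_eq_1_pos) auto
  qed
  moreover have "1 \<le> r" using r3 by simp
  ultimately show ?thesis
    using main by (intro exI[of _ \<epsilon>] conjI exI[of _ \<eta>] exI[of _ r] allI impI)
qed

section \<open>Containers for graphs without a copy of the pattern\<close>

text \<open>If \<open>H\<close> has isolated vertices, different vertex sets can give the same edge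
  set; the weight counts them all, so that degrees are numbers of copies.\<close>

definition "copy_weight n A f = (if f \<subseteq> A then real (card {S \<in> vsets n. copy S = f}) else 0)"

lemma wdeg_copy_weight:
  assumes "finite A"
  shows "wdeg A (copy_weight n A) T = real (card (copies n T A))"
proof -
  have "copies n T A = (\<Union>f\<in>{f. f \<subseteq> A \<and> T \<subseteq> f}. {S \<in> vsets n. copy S = f})"
    by (auto simp: copies_def)
  also have "card \<dots> = (\<Sum>f | f \<subseteq> A \<and> T \<subseteq> f. card {S \<in> vsets n. copy S = f})"
    using assms finite_vsets by (intro card_UN_disjoint) auto
  finally show ?thesis by (simp add: wdeg_def copy_weight_def)
qed

text \<open>As long as \<open>A\<close> has at least \<open>\<epsilon> * n ^ nv\<close> copies, the
  codegree bound \<open>q ^ (card T - 1) * n ^ (nv - 2)\<close> is at most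
  \<open>1 / \<epsilon>\<close> times \<open>q ^ (card T - 1)\<close> times the number of copies
  over \<open>n ^ 2\<close>. This is the spread condition with \<open>K = 1 / \<epsilon>\<close> and
  \<open>N = n ^ 2\<close>.\<close>

lemma container_step_copies:
  assumes "0 < \<epsilon>" "\<epsilon> \<le> 1"
  shows "\<exists>\<delta>>0. \<exists>q0>0. \<forall>n b A. 1 \<le> n \<longrightarrow> 1 \<le> b \<longrightarrow> real b / (real n)\<^sup>2 \<le> q0 \<longrightarrow>
    real n powr (- 1 / m2) \<le> real b / (real n)\<^sup>2 \<longrightarrow> A \<subseteq> pairs n \<longrightarrow>
    \<not> real (card (copies n {} A)) < \<epsilon> * real n ^ nv \<longrightarrow>
    has_containers A (\<lambda>I. copies n {} I = {}) (\<lambda>C. real (card C) \<le> real (card A) - \<delta> * (real n)\<^sup>2)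
      ((2 * ((real n)\<^sup>2 + 1) ^ b) ^ card (edges H))"
proof -
  have "1 \<le> 1 / \<epsilon>" using assms by simp
  from container_step[OF this, of "card (edges H)", where 'v = "nat set"]
  obtain \<delta> q0 where \<delta>: "0 < \<delta>" and q0: "0 < q0" and cs:
    "\<forall>(A :: nat set set) w q N b. spread_hypergraph A w (card (edges H)) (1 / \<epsilon>) q N b \<longrightarrow> q \<le> q0 \<longrightarrow>
     has_containers A (windep w) (\<lambda>C. real (card C) \<le> real (card A) - \<delta> * N)
       ((2 * (N + 1) ^ b) ^ card (edges H))"
    by (elim exE conjE) (rule that)
  have main: "has_containers A (\<lambda>I. copies n {} I = {})
      (\<lambda>C. real (card C) \<le> real (card A) - \<delta> * (real n)\<^sup>2)
      ((2 * ((real n)\<^sup>2 + 1) ^ b) ^ card (edges H))"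
    if n: "1 \<le> n" and b: "1 \<le> b" and q: "real b / (real n)\<^sup>2 \<le> q0"
      and qn: "real n powr (- 1 / m2) \<le> real b / (real n)\<^sup>2" and A: "A \<subseteq> pairs n"
      and rich: "\<not> real (card (copies n {} A)) < \<epsilon> * real n ^ nv" for n b A
  proof -
    have finA: "finite A" using A finite_pairs finite_subset by blast
    define Q where "Q = real b / (real n)\<^sup>2"
    have Q0: "0 \<le> Q" by (simp add: Q_def)
    have npos: "0 < real n" using n by simp
    have tot: "\<epsilon> * real n ^ nv \<le> real (card (copies n {} A))" using rich by simp
    have "spread_hypergraph A (copy_weight n A) (card (edges H)) (1 / \<epsilon>) Q ((real n)\<^sup>2) b"
    proof unfold_locales
      show "f \<subseteq> A \<and> card f = card (edges H)" if "copy_weight n A f \<noteq> 0" for f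
      proof -
        from that have "f \<subseteq> A" "card {S \<in> vsets n. copy S = f} \<noteq> 0"
          by (auto simp: copy_weight_def split: if_splits)
        moreover from this have "{S \<in> vsets n. copy S = f} \<noteq> {}" by (metis card.empty)
        ultimately obtain S where "S \<in> vsets n" "copy S = f" by blast
        with card_copy[of S] vsetsD[of S n] \<open>f \<subseteq> A\<close> show ?thesis by auto
      qed
      have "card A \<le> card (pairs n)" using A finite_pairs by (intro card_mono)
      then show "real (card A) \<le> (real n)\<^sup>2" using card_pairs_le[of n] by linarith
      have "0 < \<epsilon> * real n ^ nv" using assms(1) npos by simp
      with tot show "0 < wdeg A (copy_weight n A) {}"
        unfolding wdeg_copy_weight[OF finA] by linarith
      show "wdeg A (copy_weight n A) T
          \<le> 1 / \<epsilon> * Q ^ (card T - 1) * wdeg A (copy_weight n A) {} / (real n)\<^sup>2"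
        if T: "T \<noteq> {}" for T
      proof -
        have "real (card (copies n T A)) \<le> Q ^ (card T - 1) * real n ^ (nv - 2)"
          unfolding Q_def using T n qn by (rule card_copies_le)
        also have "real n ^ (nv - 2) = 1 / \<epsilon> * (\<epsilon> * real n ^ nv) / (real n)\<^sup>2"
        proof -
          have "2 + (nv - 2) = nv" using nv_ge by simp
          then have "real n ^ nv = (real n)\<^sup>2 * real n ^ (nv - 2)"
            using power_add[of "real n" 2 "nv - 2"] by (simp only:)
          then show ?thesis using assms(1) npos by simp
        qed
        also have "Q ^ (card T - 1) * (1 / \<epsilon> * (\<epsilon> * real n ^ nv) / (real n)\<^sup>2)
            \<le> Q ^ (card T - 1) * (1 / \<epsilon> * real (card (copies n {} A)) / (real n)\<^sup>2)"
          using Q0 tot assms(1) by (intro mult_left_mono divide_right_mono) auto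
        finally show ?thesis unfolding wdeg_copy_weight[OF finA] by (simp add: mult_ac)
      qed
    qed (use finA npos b assms in \<open>auto simp: copy_weight_def Q_def\<close>)
    then have cw: "has_containers A (windep (copy_weight n A))
        (\<lambda>C. real (card C) \<le> real (card A) - \<delta> * (real n)\<^sup>2)
        ((2 * ((real n)\<^sup>2 + 1) ^ b) ^ card (edges H))"
      using cs q unfolding Q_def by simp
    have "windep (copy_weight n A) I" if "copies n {} I = {}" for I
    proof -
      have "copy_weight n A f = 0" if "f \<subseteq> I" for f
      proof -
        have "{S \<in> vsets n. copy S = f} \<subseteq> copies n {} I" using that by (auto simp: copies_def)
        then have none: "{S \<in> vsets n. copy S = f} = {}" using \<open>copies n {} I = {}\<close> by blast
        show ?thesis unfolding copy_weight_def none by simp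
      qed
      then show ?thesis by (simp add: windep_def)
    qed
    then show ?thesis by (rule has_containers_mono[OF cw])
  qed
  show ?thesis
    by (rule exI[of _ \<delta>], rule conjI[OF \<delta>], rule exI[of _ q0], rule conjI[OF q0],
        intro allI impI, rule main)
qed

text \<open>Each round removes \<open>\<delta> * n ^ 2\<close> of at most \<open>n ^ 2\<close>
  pairs, so about \<open>1 / \<delta>\<close> rounds suffice. The exponent \<open>k\<close> is
  independent of \<open>n\<close> and \<open>b\<close>, which keeps the logarithm of the number of
  containers of order \<open>b * ln n\<close>.\<close>

lemma containers_copies:
  assumes "0 < \<epsilon>" "\<epsilon> \<le> 1"
  shows "\<exists>k. \<exists>q0>0. \<forall>n b. 1 \<le> n \<longrightarrow> 1 \<le> b \<longrightarrow> real b / (real n)\<^sup>2 \<le> q0 \<longrightarrow>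
    real n powr (- 1 / m2) \<le> real b / (real n)\<^sup>2 \<longrightarrow>
    has_containers (pairs n) (\<lambda>I. copies n {} I = {})
      (\<lambda>C. real (card (copies n {} C)) < \<epsilon> * real n ^ nv) ((2 * ((real n)\<^sup>2 + 1) ^ b) ^ k)"
proof -
  from container_step_copies[OF assms] obtain \<delta> q0 where \<delta>: "0 < \<delta>" and q0: "0 < q0" and step:
    "\<forall>n b A. 1 \<le> n \<longrightarrow> 1 \<le> b \<longrightarrow> real b / (real n)\<^sup>2 \<le> q0 \<longrightarrow>
    real n powr (- 1 / m2) \<le> real b / (real n)\<^sup>2 \<longrightarrow> A \<subseteq> pairs n \<longrightarrow>
    \<not> real (card (copies n {} A)) < \<epsilon> * real n ^ nv \<longrightarrow>
    has_containers A (\<lambda>I. copies n {} I = {}) (\<lambda>C. real (card C) \<le> real (card A) - \<delta> * (real n)\<^sup>2)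
      ((2 * ((real n)\<^sup>2 + 1) ^ b) ^ card (edges H))"
    by (elim exE conjE) (rule that)
  define k where "k = nat \<lceil>1 / \<delta>\<rceil>"
  have k: "1 \<le> real k * \<delta>"
  proof -
    have "1 / \<delta> \<le> real k" unfolding k_def by linarith
    then show ?thesis using \<delta> by (simp add: field_simps)
  qed
  have main: "has_containers (pairs n) (\<lambda>I. copies n {} I = {})
      (\<lambda>C. real (card (copies n {} C)) < \<epsilon> * real n ^ nv)
      ((2 * ((real n)\<^sup>2 + 1) ^ b) ^ (card (edges H) * k))"
    if n: "1 \<le> n" and b: "1 \<le> b" and q: "real b / (real n)\<^sup>2 \<le> q0"
      and qn: "real n powr (- 1 / m2) \<le> real b / (real n)\<^sup>2" for n b
    unfolding power_mult
  proof (rule iterate_containers)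
    show "0 < \<delta> * (real n)\<^sup>2" using \<delta> n by simp
    have "1 \<le> ((real n)\<^sup>2 + 1) ^ b" by (intro one_le_power) simp
    then show "1 \<le> (2 * ((real n)\<^sup>2 + 1) ^ b) ^ card (edges H)"
      by (intro one_le_power) linarith
    show "finite (pairs n)" by (rule finite_pairs)
    have "1 * (real n)\<^sup>2 \<le> real k * \<delta> * (real n)\<^sup>2" using k by (intro mult_right_mono) auto
    then show "real (card (pairs n)) \<le> real k * (\<delta> * (real n)\<^sup>2)"
      by (intro order_trans[OF card_pairs_le]) (simp add: mult.assoc)
  qed (use step n b q qn in simp)
  show ?thesis
    by (rule exI[of _ "card (edges H) * k"], rule exI[of _ q0], rule conjI[OF q0],
        intro allI impI, rule main)
qed

subsection \<open>Locally sparse Ramsey graphs\<close>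

text \<open>Finitely many strict inequalities leave room to raise \<open>m\<close>. With
  \<open>p = n powr (- 1 / \<theta>)\<close> they make each \<open>n ^ u * p ^ g u\<close> tend to
  0.\<close>

lemma exponent_above:
  fixes g :: "nat \<Rightarrow> real" and m :: real
  assumes "\<And>u. m * real u < g u"
  shows "\<exists>\<theta>>m. \<forall>u\<in>{1..K}. \<theta> * real u < g u"
proof (induction K)
  case 0
  show ?case by (intro exI[of _ "m + 1"]) simp
next
  case (Suc K)
  then obtain \<theta> where \<theta>: "m < \<theta>" "\<forall>u\<in>{1..K}. \<theta> * real u < g u" by blast
  have "m < g (Suc K) / real (Suc K)"
    using assms[of "Suc K"] by (subst pos_less_divide_eq) auto
  with \<theta>(1) obtain \<theta>' where \<theta>': "m < \<theta>'" "\<theta>' < min \<theta> (g (Suc K) / real (Suc K))"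
    using dense[of m "min \<theta> (g (Suc K) / real (Suc K))"] by auto
  have "\<theta>' * real u < g u" if "u \<in> {1..Suc K}" for u
  proof (cases "u = Suc K")
    case True
    have "\<theta>' < g (Suc K) / real (Suc K)" using \<theta>' by simp
    then show ?thesis unfolding True by (subst (asm) pos_less_divide_eq) auto
  next
    case False
    with that have u: "u \<in> {1..K}" by auto
    have "\<theta>' * real u \<le> \<theta> * real u" using \<theta>' by (intro mult_right_mono) auto
    with \<theta>(2)[rule_format, OF u] show ?thesis by linarith
  qed
  with \<theta>'(1) show ?case by blast
qed

text \<open>In a colouring without monochromatic copy both colour classes are free of copies, so
  each lies in a container and \<open>G\<close> lies in the union of the two.\<close>

lemma ramsey_if_avoids_containers:
  assumes G: "G \<subseteq> pairs n"
    and cover: "\<And>I. I \<subseteq> pairs n \<Longrightarrow> copies n {} I = {} \<Longrightarrow> \<exists>C\<in>\<C>. I \<subseteq> C"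
    and avoid: "\<And>C1 C2. C1 \<in> \<C> \<Longrightarrow> C2 \<in> \<C> \<Longrightarrow> \<not> G \<subseteq> C1 \<union> C2"
  shows "OGraph {..<n} G \<in> ramsey_graphs H"
proof -
  have "\<exists>C. is_copy H (OGraph {..<n} G) C \<and> Defs.monochromatic c C" for c :: "nat set \<Rightarrow> bool"
  proof (rule ccontr)
    assume no: "\<not> ?thesis"
    have "copies n {} {e \<in> G. c e = col} = {}" for col
    proof (rule ccontr)
      assume "copies n {} {e \<in> G. c e = col} \<noteq> {}"
      then obtain S where S: "S \<in> vsets n" "copy S \<subseteq> {e \<in> G. c e = col}" by (auto simp: copies_def)
      then have "is_copy H (OGraph {..<n} G) (OGraph S (copy S))"
        using G by (intro copy_is_copy) auto
      moreover have "Defs.monochromatic c (OGraph S (copy S))"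
        using S(2) by (auto simp: Defs.monochromatic_def)
      ultimately show False using no by blast
    qed
    then have col: "\<exists>C\<in>\<C>. {e \<in> G. c e = col} \<subseteq> C" for col
      using G by (intro cover) auto
    obtain C1 C2 where "C1 \<in> \<C>" "{e \<in> G. c e = True} \<subseteq> C1" "C2 \<in> \<C>" "{e \<in> G. c e = False} \<subseteq> C2"
      using col[of True] col[of False] by (elim bexE) (rule that)
    then show False using avoid[of C1 C2] by blast
  qed
  moreover have "ordered_graph (OGraph {..<n} G)"
    using G by (auto simp: ordered_graph_def pairs_def)
  ultimately show ?thesis by (simp add: ramsey_graphs_def)
qed

text \<open>The left side is the expected number of ways to find \<open>g u\<close> random edges
  inside a set \<open>U\<close> of \<open>u\<close> vertices. There are at most \<open>n ^ u\<close>
  sets \<open>U\<close>, and at most \<open>2 ^ 2 ^ K\<close> families \<open>W\<close> within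
  \<open>Pow U\<close>.\<close>

lemma expected_dense_sets:
  fixes g :: "nat \<Rightarrow> nat" and p :: real
  assumes "0 \<le> p"
  shows "(\<Sum>(u, U, W)\<in>(SIGMA u:{1..K}. SIGMA U:{U. U \<subseteq> {..<n} \<and> card U = u}. {W. W \<subseteq> Pow U \<and> W \<subseteq> pairs n \<and> card W = g u}).
      p ^ card W) \<le> (\<Sum>u\<in>{1..K}. 2 ^ 2 ^ K * real n ^ u * p ^ g u)"
proof -
  have fU: "finite {U. U \<subseteq> {..<n} \<and> card U = u}" for u
    by (rule finite_subset[of _ "Pow {..<n}"]) auto
  have fW: "finite {W. W \<subseteq> Pow U \<and> W \<subseteq> pairs n \<and> card W = k}" for U k
    by (rule finite_subset[of _ "Pow (pairs n)"]) (use finite_pairs in auto)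
  have "(\<Sum>(u, U, W)\<in>(SIGMA u:{1..K}. SIGMA U:{U. U \<subseteq> {..<n} \<and> card U = u}. {W. W \<subseteq> Pow U \<and> W \<subseteq> pairs n \<and> card W = g u}).
      p ^ card W) = (\<Sum>u\<in>{1..K}. \<Sum>U | U \<subseteq> {..<n} \<and> card U = u.
        \<Sum>W | W \<subseteq> Pow U \<and> W \<subseteq> pairs n \<and> card W = g u. p ^ card W)"
    by (subst sum.Sigma[symmetric]; (intro ballI finite_SigmaI fU fW finite_atLeastAtMost)?)
       (intro sum.cong refl, subst sum.Sigma[symmetric], auto intro: fU fW)
  also have "\<dots> \<le> (\<Sum>u\<in>{1..K}. 2 ^ 2 ^ K * real n ^ u * p ^ g u)"
  proof (rule sum_mono)
    fix u assume u: "u \<in> {1..K}"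
    have "(\<Sum>W | W \<subseteq> Pow U \<and> W \<subseteq> pairs n \<and> card W = g u. p ^ card W) \<le> 2 ^ 2 ^ K * p ^ g u"
      if U: "U \<in> {U. U \<subseteq> {..<n} \<and> card U = u}" for U
    proof -
      have finU: "finite U" using U finite_subset by auto
      have "card {W. W \<subseteq> Pow U \<and> W \<subseteq> pairs n \<and> card W = g u} \<le> card (Pow (Pow U))"
        using finU by (intro card_mono) auto
      also have "\<dots> = 2 ^ 2 ^ u" using finU U by (simp add: card_Pow)
      also have "\<dots> \<le> 2 ^ 2 ^ K" using u by (intro power_increasing) auto
      finally have "real (card {W. W \<subseteq> Pow U \<and> W \<subseteq> pairs n \<and> card W = g u}) \<le> real (2 ^ 2 ^ K)"
        by (rule of_nat_mono)
      then have "real (card {W. W \<subseteq> Pow U \<and> W \<subseteq> pairs n \<and> card W = g u}) * p ^ g u \<le> 2 ^ 2 ^ K * p ^ g u"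
        using assms by (intro mult_right_mono) auto
      then show ?thesis by simp
    qed
    then have "(\<Sum>U | U \<subseteq> {..<n} \<and> card U = u. \<Sum>W | W \<subseteq> Pow U \<and> W \<subseteq> pairs n \<and> card W = g u. p ^ card W)
        \<le> (\<Sum>U | U \<subseteq> {..<n} \<and> card U = u. 2 ^ 2 ^ K * p ^ g u)"
      by (rule sum_mono)
    also have "\<dots> = real (card {U. U \<subseteq> {..<n} \<and> card U = u}) * (2 ^ 2 ^ K * p ^ g u)" by simp
    also have "\<dots> \<le> real n ^ u * (2 ^ 2 ^ K * p ^ g u)"
    proof (rule mult_right_mono)
      have "card {U. U \<subseteq> {..<n} \<and> card U = u} \<le> n ^ u"
        using card_supersets_le[of "{..<n}" "{}" u] by simp
      then show "real (card {U. U \<subseteq> {..<n} \<and> card U = u}) \<le> real n ^ u"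
        by (simp flip: of_nat_power)
    qed (use assms in simp)
    finally show "(\<Sum>U | U \<subseteq> {..<n} \<and> card U = u. \<Sum>W | W \<subseteq> Pow U \<and> W \<subseteq> pairs n \<and> card W = g u. p ^ card W)
        \<le> 2 ^ 2 ^ K * real n ^ u * p ^ g u" by (simp add: mult_ac)
  qed
  finally show ?thesis .
qed

text \<open>For large \<open>n\<close> each of the two sums in \<open>random_subset_exists\<close>
  falls below \<open>1 / 2\<close>: the one for dense vertex sets by the choice of
  \<open>\<theta>\<close>, the one for pairs of containers because \<open>p * n ^ 2\<close> outgrows
  the logarithm of their number.\<close>

lemma locally_sparse_ramsey_graph:
  "\<exists>F\<in>ramsey_graphs H. \<forall>U\<subseteq>verts F. U \<noteq> {} \<longrightarrow> card U \<le> K \<longrightarrow>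
     real (card {e \<in> edges F. e \<subseteq> U}) \<le> m2 * real (card U)"
proof -
  \<comment> \<open>The least integer exceeding \<open>m2 * u\<close>, so \<open>g u\<close> edges
    on \<open>u\<close> vertices are just too many.\<close>
  define g where "g u = nat \<lfloor>m2 * real u\<rfloor> + 1" for u
  have m2: "0 < m2" using m2_ge_half by simp
  have g: "m2 * real u < real (g u)" for u
    unfolding g_def by linarith
  obtain \<theta> where \<theta>: "m2 < \<theta>" "\<forall>u\<in>{1..K}. \<theta> * real u < real (g u)"
    using exponent_above[of m2 "\<lambda>u. real (g u)" K] g by blast
  obtain \<epsilon> \<eta> n0 where \<epsilon>: "0 < \<epsilon>" "\<epsilon> \<le> 1" and \<eta>: "0 < \<eta>" and n0: "1 \<le> n0" and sat: "\<forall>n\<ge>n0. \<forall>C1 C2. 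
     real (card (copies n {} C1)) < \<epsilon> * real n ^ nv \<longrightarrow> real (card (copies n {} C2)) < \<epsilon> * real n ^ nv \<longrightarrow>
     \<eta> * (real n)\<^sup>2 \<le> real (card (pairs n - (C1 \<union> C2)))"
    using supersaturation by (elim exE conjE) (rule that)
  obtain k q0 where q0: "0 < q0" and cont: "\<forall>n b. 1 \<le> n \<longrightarrow> 1 \<le> b \<longrightarrow> real b / (real n)\<^sup>2 \<le> q0 \<longrightarrow>
    real n powr (- 1 / m2) \<le> real b / (real n)\<^sup>2 \<longrightarrow>
    has_containers (pairs n) (\<lambda>I. copies n {} I = {})
      (\<lambda>C. real (card (copies n {} C)) < \<epsilon> * real n ^ nv) ((2 * ((real n)\<^sup>2 + 1) ^ b) ^ k)"
    using containers_copies[OF \<epsilon>] by (elim exE conjE) (rule that)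
  \<comment> \<open>For \<open>b\<close> about \<open>n powr \<alpha>\<close> the ratio
    \<open>b / n ^ 2\<close> is about \<open>n powr (- 1 / m2)\<close>, as the containers require.
    On the other side, \<open>n powr \<beta>\<close> is \<open>p * n ^ 2\<close>.\<close>
  define \<alpha> where "\<alpha> = 2 - 1 / m2"
  define \<beta> where "\<beta> = 2 - 1 / \<theta>"
  have \<alpha>: "0 \<le> \<alpha>" "\<alpha> < 2" using m2_ge_half m2 by (auto simp: \<alpha>_def field_simps)
  have \<alpha>\<beta>: "\<alpha> < \<beta>" using \<theta>(1) m2 by (simp add: \<alpha>_def \<beta>_def field_simps)
  have E1: "\<forall>\<^sub>F n in sequentially. real n powr (\<alpha> - 2) + real n powr (- 2) < q0"
  proof -
    have "(\<lambda>n. real n powr (\<alpha> - 2) + real n powr (- 2)) \<longlonglongrightarrow> 0 + 0"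
      using \<alpha> by (intro tendsto_add tendsto_neg_powr filterlim_real_sequentially) auto
    then show ?thesis using q0 by (intro order_tendstoD(2)) auto
  qed
  have E2: "\<forall>\<^sub>F n in sequentially. (\<Sum>u\<in>{1..K}. 2 ^ 2 ^ K * real n powr (real u - real (g u) / \<theta>)) < 1 / 2"
  proof -
    have "(\<lambda>n. \<Sum>u\<in>{1..K}. 2 ^ 2 ^ K * real n powr (real u - real (g u) / \<theta>)) \<longlonglongrightarrow> (\<Sum>u\<in>{1..K}. 2 ^ 2 ^ K * 0)"
    proof (intro tendsto_sum tendsto_mult tendsto_const)
      fix u assume "u \<in> {1..K}"
      then have "real u - real (g u) / \<theta> < 0" using \<theta> m2 by (simp add: field_simps)
      then show "(\<lambda>n. real n powr (real u - real (g u) / \<theta>)) \<longlonglongrightarrow> 0"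
        by (intro tendsto_neg_powr filterlim_real_sequentially)
    qed
    then have "(\<lambda>n. \<Sum>u\<in>{1..K}. 2 ^ 2 ^ K * real n powr (real u - real (g u) / \<theta>)) \<longlonglongrightarrow> 0" by simp
    then show ?thesis by (rule order_tendstoD) simp
  qed
  \<comment> \<open>\<open>X n * n powr \<beta>\<close> is
    \<open>ln 2 + (n powr \<alpha> + 1) * ln (n ^ 2 + 1)\<close>, and \<open>k\<close> times this
    bounds the logarithm of the number of containers. The last summand of \<open>X\<close> pays for
    rounding up \<open>b\<close>.\<close>
  define X where "X n = ln 2 * real n powr (- \<beta>) + real n powr (\<alpha> - \<beta>) * ln ((real n)\<^sup>2 + 1)
      + real n powr (- \<beta>) * ln ((real n)\<^sup>2 + 1)" for n
  have powr_ln: "(\<lambda>n. real n powr (- s) * ln ((real n)\<^sup>2 + 1)) \<longlonglongrightarrow> 0" if "0 < s" for s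
    using that by real_asymp
  \<comment> \<open>Counting pairs of containers squares their number, hence the factor 2; this may
    consume half of the exponent \<open>\<eta> * n powr \<beta>\<close>, and \<open>E4\<close> uses
    the other half.\<close>
  have E3: "\<forall>\<^sub>F n in sequentially. 2 * real k * X n < \<eta> / 2"
  proof -
    have "(\<lambda>n. 2 * real k * X n) \<longlonglongrightarrow> 2 * real k * (ln 2 * 0 + 0 + 0)"
      unfolding X_def
    proof (intro tendsto_mult tendsto_add tendsto_const)
      show "(\<lambda>n. real n powr (- \<beta>)) \<longlonglongrightarrow> 0"
        using \<alpha> \<alpha>\<beta> by (intro tendsto_neg_powr filterlim_real_sequentially) auto
    qed (use powr_ln[of "\<beta> - \<alpha>"] powr_ln[of \<beta>] \<alpha> \<alpha>\<beta> in auto)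
    then show ?thesis using \<eta> by (intro order_tendstoD(2)) auto
  qed
  have E4: "\<forall>\<^sub>F n in sequentially. exp (- (\<eta> / 2 * real n powr \<beta>)) < 1 / 2"
  proof -
    have "0 < \<beta>" using \<alpha> \<alpha>\<beta> by simp
    then have "(\<lambda>n. exp (- (\<eta> / 2 * real n powr \<beta>))) \<longlonglongrightarrow> 0"
      using \<eta> by real_asymp
    then show ?thesis by (rule order_tendstoD) simp
  qed
  have "\<forall>\<^sub>F n in sequentially. max n0 1 \<le> n" by (rule eventually_ge_at_top)
  with E1 E2 E3 E4 have "\<forall>\<^sub>F n in sequentially. real n powr (\<alpha> - 2) + real n powr (- 2) < q0 \<and>
      (\<Sum>u\<in>{1..K}. 2 ^ 2 ^ K * real n powr (real u - real (g u) / \<theta>)) < 1 / 2 \<and>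
      2 * real k * X n < \<eta> / 2 \<and> exp (- (\<eta> / 2 * real n powr \<beta>)) < 1 / 2 \<and> max n0 1 \<le> n"
    by (intro eventually_conj)
  then obtain n where e1: "real n powr (\<alpha> - 2) + real n powr (- 2) < q0"
    and e2: "(\<Sum>u\<in>{1..K}. 2 ^ 2 ^ K * real n powr (real u - real (g u) / \<theta>)) < 1 / 2"
    and e3: "2 * real k * X n < \<eta> / 2"
    and e4: "exp (- (\<eta> / 2 * real n powr \<beta>)) < 1 / 2"
    and n: "n0 \<le> n" "1 \<le> n"
    by (auto dest!: eventually_happens)
  have npos: "0 < real n" using n by simp
  define b where "b = nat \<lceil>real n powr \<alpha>\<rceil>"
  define p where "p = real n powr (- 1 / \<theta>)"
  have b_ge: "real n powr \<alpha> \<le> real b" unfolding b_def by linarith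
  have b_le: "real b \<le> real n powr \<alpha> + 1"
  proof -
    have "0 \<le> real n powr \<alpha>" by simp
    then show ?thesis unfolding b_def by linarith
  qed
  have b1: "1 \<le> b"
  proof -
    have "0 < real n powr \<alpha>" using npos by simp
    then have "0 < real b" using b_ge by linarith
    then show ?thesis by simp
  qed
  have p0: "0 \<le> p" by (simp add: p_def)
  have p1: "p \<le> 1"
    using powr_mono[of "- 1 / \<theta>" 0 "real n"] n \<theta>(1) m2 by (simp add: p_def)
  have "real b / (real n)\<^sup>2 \<le> (real n powr \<alpha> + 1) / (real n)\<^sup>2"
    using b_le by (intro divide_right_mono) auto
  also have "\<dots> = real n powr (\<alpha> - 2) + real n powr (- 2)"
    using npos by (simp add: powr_diff powr_minus_divide add_divide_distrib)
  finally have q: "real b / (real n)\<^sup>2 \<le> q0" using e1 by linarith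
  have "real n powr (- 1 / m2) = real n powr \<alpha> / (real n)\<^sup>2"
    using npos by (simp add: \<alpha>_def powr_diff powr_minus_divide)
  also have "\<dots> \<le> real b / (real n)\<^sup>2" using b_ge by (intro divide_right_mono) auto
  finally have qn: "real n powr (- 1 / m2) \<le> real b / (real n)\<^sup>2" .
  from cont[rule_format, OF n(2) b1 q qn] obtain \<C> where \<C>: "finite \<C>"
     "real (card \<C>) \<le> (2 * ((real n)\<^sup>2 + 1) ^ b) ^ k"
     "\<forall>C\<in>\<C>. C \<subseteq> pairs n \<and> real (card (copies n {} C)) < \<epsilon> * real n ^ nv"
     "\<forall>I. I \<subseteq> pairs n \<and> copies n {} I = {} \<longrightarrow> (\<exists>C\<in>\<C>. I \<subseteq> C)"
    unfolding has_containers_def by (elim exE conjE) (rule that)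
  define \<I> where "\<I> = (SIGMA u:{1..K}. SIGMA U:{U. U \<subseteq> {..<n} \<and> card U = u}.
      {W. W \<subseteq> Pow U \<and> W \<subseteq> pairs n \<and> card W = g u})"
  have fin\<I>: "finite \<I>"
    unfolding \<I>_def
    by (intro finite_SigmaI finite_atLeastAtMost)
       (auto intro: finite_subset[of _ "Pow {..<n}"] finite_subset[of _ "Pow (pairs n)"] finite_pairs)
  have sum1: "(\<Sum>i\<in>\<I>. p ^ card (snd (snd i))) < 1 / 2"
  proof -
    have "(\<Sum>i\<in>\<I>. p ^ card (snd (snd i))) \<le> (\<Sum>u\<in>{1..K}. 2 ^ 2 ^ K * real n ^ u * p ^ g u)"
      using expected_dense_sets[OF p0, of K n g] unfolding \<I>_def by (simp add: case_prod_unfold)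
    also have "\<dots> = (\<Sum>u\<in>{1..K}. 2 ^ 2 ^ K * real n powr (real u - real (g u) / \<theta>))"
    proof (intro sum.cong refl)
      fix u
      have "p ^ g u = real n powr (- 1 / \<theta> * real (g u))"
        using npos by (simp only: p_def powr_power powr_gt_zero powr_realpow[symmetric] powr_powr)
      then show "2 ^ 2 ^ K * real n ^ u * p ^ g u = 2 ^ 2 ^ K * real n powr (real u - real (g u) / \<theta>)"
        using npos by (simp add: powr_realpow[symmetric] powr_diff powr_minus_divide)
    qed
    finally show ?thesis using e2 by linarith
  qed
  have sum2: "(\<Sum>j\<in>\<C> \<times> \<C>. (1 - p) ^ card (pairs n - (fst j \<union> snd j))) < 1 / 2"
  proof -
    \<comment> \<open>By supersaturation at least \<open>\<eta> * n ^ 2\<close> pairs lie outside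
      both containers, and a random graph inside their union avoids all of them.\<close>
    have "(1 - p) ^ card (pairs n - (fst j \<union> snd j)) \<le> exp (- (\<eta> * real n powr \<beta>))"
      if "j \<in> \<C> \<times> \<C>" for j
    proof -
      define m where "m = card (pairs n - (fst j \<union> snd j))"
      have m: "\<eta> * (real n)\<^sup>2 \<le> real m"
        unfolding m_def using sat n(1) \<C>(3) that by auto
      have "(1 - p) ^ m \<le> exp (- p) ^ m"
        using p1 exp_ge_add_one_self[of "- p"] by (intro power_mono) auto
      also have "\<dots> = exp (- (p * real m))" by (simp flip: exp_of_nat_mult add: mult.commute)
      also have "\<dots> \<le> exp (- (p * (\<eta> * (real n)\<^sup>2)))"
        using m p0 by (simp add: mult_left_mono)
      also have "p * (\<eta> * (real n)\<^sup>2) = \<eta> * real n powr \<beta>"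
        using npos by (simp add: p_def \<beta>_def powr_diff powr_minus_divide)
      finally show ?thesis unfolding m_def .
    qed
    then have "(\<Sum>j\<in>\<C> \<times> \<C>. (1 - p) ^ card (pairs n - (fst j \<union> snd j)))
        \<le> (\<Sum>j\<in>\<C> \<times> \<C>. exp (- (\<eta> * real n powr \<beta>)))"
      by (rule sum_mono)
    also have "\<dots> = (real (card \<C>))\<^sup>2 * exp (- (\<eta> * real n powr \<beta>))"
      using \<C>(1) by (simp add: card_cartesian_product power2_eq_square)
    also have "\<dots> \<le> (exp (real k * (ln 2 + (real n powr \<alpha> + 1) * ln ((real n)\<^sup>2 + 1))))\<^sup>2 * exp (- (\<eta> * real n powr \<beta>))"
    proof (intro mult_right_mono power_mono)
      have "(2 * ((real n)\<^sup>2 + 1) ^ b) ^ k = exp (real k * (ln 2 + real b * ln ((real n)\<^sup>2 + 1)))"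
      proof -
        have pos: "0 < (real n)\<^sup>2 + 1" using npos by (simp add: add_pos_pos)
        have "2 * ((real n)\<^sup>2 + 1) ^ b = exp (ln 2 + real b * ln ((real n)\<^sup>2 + 1))"
          using pos by (simp add: exp_add exp_of_nat_mult)
        then show ?thesis by (simp add: exp_of_nat_mult)
      qed
      also have "\<dots> \<le> exp (real k * (ln 2 + (real n powr \<alpha> + 1) * ln ((real n)\<^sup>2 + 1)))"
        using b_le by (simp add: mult_left_mono mult_right_mono)
      finally show "real (card \<C>) \<le> exp (real k * (ln 2 + (real n powr \<alpha> + 1) * ln ((real n)\<^sup>2 + 1)))"
        using \<C>(2) by linarith
    qed auto
    also have "\<dots> = exp (2 * (real k * (ln 2 + (real n powr \<alpha> + 1) * ln ((real n)\<^sup>2 + 1))) - \<eta> * real n powr \<beta>)"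
      by (simp only: exp_double exp_diff exp_minus divide_inverse)
    also have "\<dots> \<le> exp (- (\<eta> / 2 * real n powr \<beta>))"
    proof -
      have "2 * (real k * (ln 2 + (real n powr \<alpha> + 1) * ln ((real n)\<^sup>2 + 1)))
          = 2 * real k * X n * real n powr \<beta>"
        using npos by (simp add: X_def powr_diff powr_minus field_simps)
      also have "\<dots> \<le> \<eta> / 2 * real n powr \<beta>"
        using e3 by (intro mult_right_mono) auto
      finally show ?thesis by simp
    qed
    finally show ?thesis using e4 by linarith
  qed
  have "\<exists>G\<subseteq>pairs n. (\<forall>i\<in>\<I>. \<not> snd (snd i) \<subseteq> G) \<and> (\<forall>j\<in>\<C> \<times> \<C>. \<not> G \<subseteq> fst j \<union> snd j)"
  proof (rule random_subset_exists)
    show "(\<Sum>i\<in>\<I>. p ^ card (snd (snd i))) + (\<Sum>j\<in>\<C> \<times> \<C>. (1 - p) ^ card (pairs n - (fst j \<union> snd j))) < 1"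
      using sum1 sum2 by linarith
    show "snd (snd i) \<subseteq> pairs n" if "i \<in> \<I>" for i
      using that unfolding \<I>_def by auto
  qed (use finite_pairs p0 p1 fin\<I> \<C>(1) in auto)
  then obtain G where G: "G \<subseteq> pairs n" and sparse: "\<forall>i\<in>\<I>. \<not> snd (snd i) \<subseteq> G"
    and avoid: "\<forall>j\<in>\<C> \<times> \<C>. \<not> G \<subseteq> fst j \<union> snd j"
    by blast
  have "OGraph {..<n} G \<in> ramsey_graphs H"
  proof (rule ramsey_if_avoids_containers[OF G])
    show "\<exists>C\<in>\<C>. I \<subseteq> C" if "I \<subseteq> pairs n" "copies n {} I = {}" for I
      using \<C>(4) that by simp
    show "\<not> G \<subseteq> C1 \<union> C2" if "C1 \<in> \<C>" "C2 \<in> \<C>" for C1 C2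
      using avoid that by auto
  qed
  moreover have "real (card {e \<in> G. e \<subseteq> U}) \<le> m2 * real (card U)"
    if U: "U \<subseteq> {..<n}" "U \<noteq> {}" "card U \<le> K" for U
  proof (rule ccontr)
    assume "\<not> ?thesis"
    then have "m2 * real (card U) < real (card {e \<in> G. e \<subseteq> U})" by simp
    moreover have "0 \<le> m2 * real (card U)" using m2 by simp
    \<comment> \<open>More than \<open>m2 * card U\<close> edges means at least
      \<open>g (card U)\<close>, so some \<open>W\<close> indexed by \<open>\<I>\<close> would lie
      in \<open>G\<close>.\<close>
    ultimately have "g (card U) \<le> card {e \<in> G. e \<subseteq> U}"
      unfolding g_def by linarith
    then obtain W where W: "W \<subseteq> {e \<in> G. e \<subseteq> U}" "card W = g (card U)"
      by (rule obtain_subset_with_card_n)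
    have "finite U" using U(1) finite_subset by auto
    then have "1 \<le> card U" using U(2) by (simp add: Suc_leI card_gt_0_iff)
    then have "(card U, U, W) \<in> \<I>" using U W G unfolding \<I>_def by auto
    then show False using sparse W(1) by fastforce
  qed
  ultimately show ?thesis by (intro bexI[of _ "OGraph {..<n} G"]) auto
qed

end

subsection \<open>Minimal Ramsey graphs\<close>

text \<open>Vertices and edges are counted together because a proper subgraph may lose only edges or
  only isolated vertices.\<close>

lemma minimal_ramsey_subgraph:
  assumes "F \<in> ramsey_graphs H"
  shows "\<exists>F'. subgraph F' F \<and> F' \<in> minimal_ramsey_graphs H"
proof -
  have refl: "subgraph F F" if "F \<in> ramsey_graphs H" for F :: "nat ograph"
    using that by (simp add: subgraph_def ramsey_graphs_def)
  define P where "P F' \<longleftrightarrow> subgraph F' F \<and> F' \<in> ramsey_graphs H" for F'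
  define M where "M F' = card (verts F') + card (edges F')" for F' :: "nat ograph"
  obtain F' where F': "P F'" "\<And>F''. P F'' \<Longrightarrow> M F' \<le> M F''"
    using ex_has_least_nat[of P F M] refl[OF assms] assms by (auto simp: P_def)
  have "F'' \<notin> ramsey_graphs H" if F'': "subgraph F'' F'" "F'' \<noteq> F'" for F''
  proof
    assume "F'' \<in> ramsey_graphs H"
    then have "P F''" using F''(1) F'(1) by (auto simp: P_def subgraph_def)
    then have le: "M F' \<le> M F''" by (rule F'(2))
    have fin: "finite (verts F')" "finite (edges F')"
      using F''(1) finite_edges_ordered_graph by (auto simp: subgraph_def ordered_graph_def)
    have sub: "verts F'' \<subseteq> verts F'" "edges F'' \<subseteq> edges F'" using F''(1) by (auto simp: subgraph_def)
    have "card (verts F'') \<le> card (verts F')" "card (edges F'') \<le> card (edges F')"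
      using fin sub by (auto intro: card_mono)
    with le have "card (verts F'') = card (verts F')" "card (edges F'') = card (edges F')"
      by (auto simp: M_def)
    then have "verts F'' = verts F'" "edges F'' = edges F'"
      using card_subset_eq[OF fin(1) sub(1)] card_subset_eq[OF fin(2) sub(2)] by auto
    then show False using F''(2) by (simp add: ograph.expand)
  qed
  then show ?thesis using F'(1) by (auto simp: P_def minimal_ramsey_graphs_def)
qed

lemma density_attained:
  assumes "ordered_graph F"
  shows "\<exists>G. subgraph G F \<and> density F = real (card (edges G)) / real (card (verts G))"
proof -
  let ?S = "{real (card (edges G')) / real (card (verts G')) | G'. subgraph G' F}"
  have fin: "finite (verts F)" "finite (edges F)"
    using assms by (simp_all add: ordered_graph_def finite_edges_ordered_graph)
  have "?S \<subseteq> (\<lambda>(V, E). real (card E) / real (card V)) ` (Pow (verts F) \<times> Pow (edges F))"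
    by (force simp: subgraph_def)
  then have "finite ?S" using fin finite_subset by blast
  moreover have "subgraph F F" using assms by (simp add: subgraph_def)
  then have "?S \<noteq> {}" by blast
  ultimately have "density F \<in> ?S" unfolding density_def by (rule Max_in)
  then show ?thesis by blast
qed

text \<open>Shows that the density hypothesis of the theorem fails without edges: a copy of
  \<open>H\<close> is vacuously monochromatic, so it is a Ramsey graph itself, and both densities
  are 0.\<close>

lemma edgeless_ramsey_graph:
  assumes "ordered_graph H" "edges H = {}"
  shows "\<exists>F\<in>ramsey_graphs H. density F \<le> two_density H"
proof -
  obtain F :: "nat ograph" where F: "ordered_graph F" "ograph_iso H F"
    using ex_nat_ograph_iso[OF assms(1)] by blast
  then have E: "edges F = {}" using assms(2) by (auto simp: ograph_iso_def)
  have "F \<in> ramsey_graphs H"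
    using F E by (auto simp: ramsey_graphs_def is_copy_def subgraph_def Defs.monochromatic_def)
  moreover obtain G where "subgraph G F" "density F = real (card (edges G)) / real (card (verts G))"
    using density_attained[OF F(1)] by blast
  then have "density F = 0" using E by (auto simp: subgraph_def)
  moreover have "two_density H = 0"
  proof -
    have "\<not> (subgraph G' H \<and> card (verts G') \<ge> 3 \<and> card (edges G') \<ge> 1)" for G' :: "'a ograph"
      using assms(2) by (auto simp: subgraph_def)
    then show ?thesis unfolding two_density_def by (simp only: simp_thms ex_simps) simp
  qed
  ultimately show ?thesis by (intro bexI[of _ F]) auto
qed

text \<open>The case of one edge is excluded because \<open>two_density\<close> is then 0: every
  Ramsey graph of a single edge on two vertices has density at least \<open>1 / 2\<close>, and yet
  that edge is the only minimal one.\<close>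

theorem theorem7:
  fixes H :: "'a::linorder ograph"
  assumes "ordered_graph H"
    and "card (edges H) \<noteq> 1"
    and "\<And>F. F \<in> ramsey_graphs H \<Longrightarrow> density F > two_density H"
  shows "ramsey_infinite H"
proof
  assume fin: "ramsey_finite H"
  have "edges H \<noteq> {}"
    using edgeless_ramsey_graph[OF assms(1)] assms(3) by fastforce
  moreover have "finite (edges H)"
    using assms(1) by (rule finite_edges_ordered_graph)
  ultimately have "2 \<le> card (edges H)"
    using assms(2) by (metis One_nat_def Suc_1 card_gt_0_iff le_SucE not_less_eq_eq Suc_leI le_antisym)
  then interpret pattern H using assms(1) by unfold_locales
  define R where "R = {(F :: nat ograph, F' :: nat ograph). ograph_iso F F'}"
  \<comment> \<open>Finitely many representatives of the isomorphism classes, whose sizes then have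
    a common bound \<open>K\<close>.\<close>
  have "\<exists>\<F>\<subseteq>minimal_ramsey_graphs H. finite \<F> \<and> minimal_ramsey_graphs H // R = (\<lambda>F. R `` {F}) ` \<F>"
  proof -
    have "minimal_ramsey_graphs H // R = (\<lambda>F. R `` {F}) ` minimal_ramsey_graphs H"
      by (auto simp: quotient_def)
    moreover have "finite (minimal_ramsey_graphs H // R)"
      using fin by (simp add: ramsey_finite_def R_def)
    ultimately show ?thesis using finite_subset_image by (metis (no_types, lifting) order_refl)
  qed
  then obtain \<F> where \<F>: "\<F> \<subseteq> minimal_ramsey_graphs H" "finite \<F>"
      "minimal_ramsey_graphs H // R = (\<lambda>F. R `` {F}) ` \<F>" by blast
  have finv: "finite (verts F)" if "F \<in> \<F>" for F
    using that \<F>(1) by (auto simp: minimal_ramsey_graphs_def ramsey_graphs_def ordered_graph_def)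
  obtain K where K: "\<And>F. F \<in> \<F> \<Longrightarrow> card (verts F) \<le> K"
  proof
    show "card (verts F) \<le> Max ((\<lambda>F. card (verts F)) ` \<F>)" if "F \<in> \<F>" for F
      using that \<F>(2) by (intro Max_ge) auto
  qed
  from locally_sparse_ramsey_graph[of K] obtain G where G: "G \<in> ramsey_graphs H"
    and sparse: "\<forall>U\<subseteq>verts G. U \<noteq> {} \<longrightarrow> card U \<le> K \<longrightarrow>
      real (card {e \<in> edges G. e \<subseteq> U}) \<le> m2 * real (card U)"
    by (elim bexE) (rule that)
  obtain M where M: "subgraph M G" "M \<in> minimal_ramsey_graphs H"
    using minimal_ramsey_subgraph[OF G] by blast
  have "ograph_iso M M"
    unfolding ograph_iso_def by (intro exI[of _ id]) (auto simp: strict_mono_on_def)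
  \<comment> \<open>The class of \<open>M\<close> is that of a representative \<open>F\<close>, and
    by reflexivity \<open>M\<close> belongs to it; this gives an isomorphism from \<open>F\<close>
    to \<open>M\<close>.\<close>
  have "R `` {M} \<in> (\<lambda>F. R `` {F}) ` \<F>"
    using quotientI[OF M(2), of R] unfolding \<F>(3) .
  then obtain F where F: "F \<in> \<F>" "R `` {M} = R `` {F}" by (elim imageE) (rule that)
  have "M \<in> R `` {M}" using \<open>ograph_iso M M\<close> by (simp add: R_def)
  then have "M \<in> R `` {F}" unfolding F(2) .
  then obtain f where f: "bij_betw f (verts F) (verts M)" "edges M = (\<lambda>e. f ` e) ` edges F"
    by (auto simp: R_def ograph_iso_def)
  have Fr: "F \<in> ramsey_graphs H" using F(1) \<F>(1) by (auto simp: minimal_ramsey_graphs_def)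
  then have oF: "ordered_graph F" by (simp add: ramsey_graphs_def)
  obtain J where J: "subgraph J F" "density F = real (card (edges J)) / real (card (verts J))"
    using density_attained[OF oF] by blast
  have dens: "m2 < real (card (edges J)) / real (card (verts J))"
    using assms(3)[OF Fr] J(2) by (simp add: m2_def)
  have vJ: "verts J \<subseteq> verts F" "edges J \<subseteq> edges F" "\<And>e. e \<in> edges J \<Longrightarrow> e \<subseteq> verts J" "finite (verts J)"
    using J(1) by (auto simp: subgraph_def ordered_graph_def)
  \<comment> \<open>The empty subgraph has quotient \<open>0 / 0 = 0\<close>, which cannot exceed
    \<open>m2\<close>.\<close>
  have ne: "verts J \<noteq> {}" using dens m2_ge_half by auto
  have inj: "inj_on f (verts F)" and im: "f ` verts F = verts M" using f(1) by (auto simp: bij_betw_def)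
  \<comment> \<open>The densest part of \<open>F\<close>, carried into \<open>G\<close> by the
    isomorphism: at most \<open>K\<close> vertices with too many edges.\<close>
  define U where "U = f ` verts J"
  have cU: "card U = card (verts J)"
    unfolding U_def using inj vJ(1) by (intro card_image) (rule inj_on_subset)
  have Usub: "U \<subseteq> verts G" using vJ(1) im M(1) by (auto simp: U_def subgraph_def)
  have finG: "finite (edges G)"
    using M(1) by (intro finite_edges_ordered_graph) (simp add: subgraph_def)
  have "card (edges J) = card ((\<lambda>e. f ` e) ` edges J)"
  proof (rule card_image[symmetric], rule inj_onI)
    fix x y assume "x \<in> edges J" "y \<in> edges J" "f ` x = f ` y"
    then show "x = y" using inj vJ(1,3) by (meson inj_on_image_eq_iff subset_trans)
  qed
  also have "\<dots> \<le> card {e \<in> edges G. e \<subseteq> U}"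
  proof (rule card_mono)
    show "(\<lambda>e. f ` e) ` edges J \<subseteq> {e \<in> edges G. e \<subseteq> U}"
      using vJ(2,3) f(2) M(1) by (fastforce simp: U_def subgraph_def)
  qed (use finG in simp)
  finally have *: "card (edges J) \<le> card {e \<in> edges G. e \<subseteq> U}" .
  have "real (card (edges J)) \<le> m2 * real (card U)"
  proof -
    have "U \<noteq> {}" using ne by (simp add: U_def)
    moreover have "card U \<le> K"
      using cU K[OF F(1)] card_mono[OF finv[OF F(1)] vJ(1)] by linarith
    ultimately have "real (card {e \<in> edges G. e \<subseteq> U}) \<le> m2 * real (card U)"
      using sparse Usub by simp
    with * show ?thesis by linarith
  qed
  moreover have "m2 * real (card (verts J)) < real (card (edges J))"
    using dens ne vJ(4) by (simp add: pos_less_divide_eq card_gt_0_iff)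
  ultimately show False using cU by simp
qed

end
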